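(* Let $n\ge1$ and $\ell\ge 2$ be natural numbers. Every $\Delta^0_n$ instance of $\mathsf{Borel}\text{-}\mathsf{DRT}^2_\ell$ has a $\Delta^0_n$ solution. That is, if $(\omega)^2=\bigcup_{i<\ell}C_i$ is a coloring (the $C_i$ pairwise disjoint) such that each $C_i$ has a computable Borel code as a $\Delta^0_n$ set, then there are a $\Delta^0_n$ partition $p\in(\omega)^\omega$ and an $i<\ell$ such that $(p)^2\subseteq C_i$.
   Context: Partitions: $k$ is identified with $\{0,\dots,k-1\}$. For $k\le s\le\omega$, $(s)^k$ is the set of surjections $p:s\to k$ that are ordered: $\min p^{-1}(i)<\min p^{-1}(j)$ whenever $i<j<k$. $(<\omega)^k=\bigcup_{r\in\omega}(r)^k$. For $p\in(\omega)^\omega$, $(p)^2=\{x\circ p:x\in(\omega)^2\}$. For $\sigma\in(<\omega)^2$, $[\sigma]=\{p\in(\omega)^2:\sigma\prec p\}$. A partition $p$ is $\Delta^0_n$ if it is a $\Delta^0_n$ function $\omega\to\omega$. Borel codes: let $L$ be a countable set of labels effectively coding the clopen sets $\emptyset$, $(\omega)^2$, $[\sigma]$ and $\overline{[\sigma]}$ for $\sigma\in(<\omega)^2$ (bars denote complements in $(\omega)^2$). A Borel code for a $\mathbf\Sigma^0_0$ or $\mathbf\Pi^0_0$ set is a labeled tree consisting of just a root labeled by an element of $L$, representing that clopen set. For $m\ge1$, a Borel code for a $\mathbf\Sigma^0_m$ set is a labeled tree whose root is labeled $\cup$ and whose subtrees attached at level 1 are each a Borel code for a $\mathbf\Sigma^0_{\beta_j}$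 or $\mathbf\Pi^0_{\beta_j}$ set $A_j$ for some $\beta_j<m$; it represents $\bigcup_jA_j$. A Borel code for a $\mathbf\Pi^0_m$ set is the same with root labeled $\cap$, representing $\bigcap_jA_j$. A Borel code for a $\mathbf\Delta^0_m$ set ($m\ge 1$) is a pair of labeled trees coding the same set, one as a $\mathbf\Sigma^0_m$ set and the other as a $\mathbf\Pi^0_m$ set. A Borel code is computable if it is computable as a labeled subtree (or pair of such) of $\omega^{<\omega}$. *)

theory Defs
  imports Main "HOL-Library.Nat_Bijection" "HOL-Library.Disjoint_Sets"
begin

section \<open>Recursive functions and the arithmetical hierarchy\<close>

datatype recf =
    Zero
  | Succ
  | Proj nat
  | Comp recf "recf list"
  | PrimRec recf recf
  | Mu recf

text \<open>\<open>rec_eval f xs y\<close>: the partial recursive function \<open>f\<close> converges on \<open>xs\<close> with value \<open>y\<close>.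
  The recursion variable and the minimisation variable are the first argument.\<close>

inductive rec_eval :: "recf \<Rightarrow> nat list \<Rightarrow> nat \<Rightarrow> bool" where
  "rec_eval Zero xs 0"
| "rec_eval Succ [x] (Suc x)"
| "i < length xs \<Longrightarrow> rec_eval (Proj i) xs (xs ! i)"
| "list_all2 (\<lambda>g y. rec_eval g xs y) gs ys \<Longrightarrow> rec_eval f ys z \<Longrightarrow> rec_eval (Comp f gs) xs z"
| "rec_eval f xs y \<Longrightarrow> rec_eval (PrimRec f g) (0 # xs) y"
| "rec_eval (PrimRec f g) (m # xs) y \<Longrightarrow> rec_eval g (m # y # xs) z
    \<Longrightarrow> rec_eval (PrimRec f g) (Suc m # xs) z"
| "rec_eval f (m # xs) 0 \<Longrightarrow> \<forall>k<m. \<exists>y. rec_eval f (k # xs) (Suc y) \<Longrightarrow> rec_eval (Mu f) xs m"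

definition computable :: "nat \<Rightarrow> (nat list \<Rightarrow> nat) \<Rightarrow> bool" where
  "computable k F \<longleftrightarrow> (\<exists>f. \<forall>xs. length xs = k \<longrightarrow> rec_eval f xs (F xs))"

definition decidable :: "nat \<Rightarrow> (nat list \<Rightarrow> bool) \<Rightarrow> bool" where
  "decidable k R \<longleftrightarrow> computable k (\<lambda>xs. if R xs then 1 else 0)"

text \<open>\<open>k\<close>-ary relations; \<open>\<not> Q\<close> is \<open>\<Pi>\<^sup>0\<^sub>n\<close> when \<open>Q\<close> is \<open>\<Sigma>\<^sup>0\<^sub>n\<close>.\<close>

primrec Sigma0 :: "nat \<Rightarrow> nat \<Rightarrow> (nat list \<Rightarrow> bool) \<Rightarrow> bool" where
  "Sigma0 0 k R \<longleftrightarrow> decidable k R"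
| "Sigma0 (Suc n) k R \<longleftrightarrow>
    (\<exists>Q. Sigma0 n (Suc k) Q \<and> (\<forall>xs. length xs = k \<longrightarrow> (R xs \<longleftrightarrow> (\<exists>y. \<not> Q (y # xs)))))"

definition Pi0 :: "nat \<Rightarrow> nat \<Rightarrow> (nat list \<Rightarrow> bool) \<Rightarrow> bool" where
  "Pi0 n k R \<longleftrightarrow> Sigma0 n k (\<lambda>xs. \<not> R xs)"

definition Delta0 :: "nat \<Rightarrow> nat \<Rightarrow> (nat list \<Rightarrow> bool) \<Rightarrow> bool" where
  "Delta0 n k R \<longleftrightarrow> Sigma0 n k R \<and> Pi0 n k R"

definition Delta0_fun :: "nat \<Rightarrow> (nat \<Rightarrow> nat) \<Rightarrow> bool" where
  "Delta0_fun n p \<longleftrightarrow> Delta0 n 2 (\<lambda>xs. p (xs ! 0) = xs ! 1)"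

section \<open>Ordered partitions\<close>

text \<open>The ordinals \<open>k < \<omega>\<close> and \<open>\<omega>\<close> are rendered as the sets \<open>{..<k}\<close> and \<open>UNIV\<close>.\<close>

definition ordered_surj :: "nat set \<Rightarrow> nat set \<Rightarrow> (nat \<Rightarrow> nat) \<Rightarrow> bool" where
  "ordered_surj S K p \<longleftrightarrow> p ` S = K \<and>
    (\<forall>i\<in>K. \<forall>j\<in>K. i < j \<longrightarrow> (LEAST a. a \<in> S \<and> p a = i) < (LEAST a. a \<in> S \<and> p a = j))"

definition omega_parts :: "nat set \<Rightarrow> (nat \<Rightarrow> nat) set" where
  "omega_parts K = {p. ordered_surj UNIV K p}"

abbreviation omega_two :: "(nat \<Rightarrow> nat) set" where
  "omega_two \<equiv> omega_parts {..<2}"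

abbreviation omega_omega :: "(nat \<Rightarrow> nat) set" where
  "omega_omega \<equiv> omega_parts UNIV"

text \<open>The elements of \<open>(<\<omega>)\<^sup>2\<close> as lists of values.\<close>

definition finite_two :: "nat list set" where
  "finite_two = {\<sigma>. ordered_surj {..<length \<sigma>} {..<2} (\<lambda>a. \<sigma> ! a)}"

definition cylinder :: "nat list \<Rightarrow> (nat \<Rightarrow> nat) set" where
  "cylinder \<sigma> = {p \<in> omega_two. \<forall>a<length \<sigma>. p a = \<sigma> ! a}"

definition coarsenings_two :: "(nat \<Rightarrow> nat) \<Rightarrow> (nat \<Rightarrow> nat) set" where
  "coarsenings_two p = {x \<circ> p | x. x \<in> omega_two}"

section \<open>Borel codes\<close>

datatype clopen_label = Empty | Full | Cyl "nat list" | CoCyl "nat list"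

definition clopen_labels :: "clopen_label set" where
  "clopen_labels = {Empty, Full} \<union> Cyl ` finite_two \<union> CoCyl ` finite_two"

primrec clopen_set :: "clopen_label \<Rightarrow> (nat \<Rightarrow> nat) set" where
  "clopen_set Empty = {}"
| "clopen_set Full = omega_two"
| "clopen_set (Cyl \<sigma>) = cylinder \<sigma>"
| "clopen_set (CoCyl \<sigma>) = omega_two - cylinder \<sigma>"

datatype label = Leaf clopen_label | Cup | Cap

text \<open>A labeled subtree of \<open>\<omega>\<^sup><\<^sup>\<omega>\<close> is its labeling function; \<open>None\<close> means not a node.\<close>

type_synonym ltree = "nat list \<Rightarrow> label option"

definition is_ltree :: "ltree \<Rightarrow> bool" where
  "is_ltree T \<longleftrightarrow> [] \<in> dom T \<and> (\<forall>\<nu> j. \<nu> @ [j] \<in> dom T \<longrightarrow> \<nu> \<in> dom T)"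

definition level1 :: "ltree \<Rightarrow> nat set" where
  "level1 T = {j. [j] \<in> dom T}"

definition attached :: "ltree \<Rightarrow> nat \<Rightarrow> ltree" where
  "attached T j = (\<lambda>\<nu>. T (j # \<nu>))"

text \<open>\<open>Sigma_code m T A\<close> (\<open>Pi_code m T A\<close>): the tree \<open>T\<close> is a Borel code for a \<open>\<Sigma>\<^sup>0\<^sub>m\<close> (\<open>\<Pi>\<^sup>0\<^sub>m\<close>) set,
  and it represents \<open>A\<close>. Intersections are taken inside \<open>(\<omega>)\<^sup>2\<close>, so the empty one is \<open>(\<omega>)\<^sup>2\<close>.\<close>

inductive Sigma_code :: "nat \<Rightarrow> ltree \<Rightarrow> (nat \<Rightarrow> nat) set \<Rightarrow> bool"
  and Pi_code :: "nat \<Rightarrow> ltree \<Rightarrow> (nat \<Rightarrow> nat) set \<Rightarrow> bool" where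
  Sigma_leaf: "c \<in> clopen_labels \<Longrightarrow> dom T = {[]} \<Longrightarrow> T [] = Some (Leaf c)
    \<Longrightarrow> Sigma_code 0 T (clopen_set c)"
| Pi_leaf: "c \<in> clopen_labels \<Longrightarrow> dom T = {[]} \<Longrightarrow> T [] = Some (Leaf c)
    \<Longrightarrow> Pi_code 0 T (clopen_set c)"
| Sigma_node: "m \<ge> 1 \<Longrightarrow> is_ltree T \<Longrightarrow> T [] = Some Cup
    \<Longrightarrow> \<forall>j\<in>level1 T. \<exists>\<beta><m. Sigma_code \<beta> (attached T j) (A j) \<or> Pi_code \<beta> (attached T j) (A j)
    \<Longrightarrow> Sigma_code m T (\<Union>j\<in>level1 T. A j)"
| Pi_node: "m \<ge> 1 \<Longrightarrow> is_ltree T \<Longrightarrow> T [] = Some Cap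
    \<Longrightarrow> \<forall>j\<in>level1 T. \<exists>\<beta><m. Sigma_code \<beta> (attached T j) (A j) \<or> Pi_code \<beta> (attached T j) (A j)
    \<Longrightarrow> Pi_code m T (omega_two \<inter> (\<Inter>j\<in>level1 T. A j))"

definition Delta_code :: "nat \<Rightarrow> ltree \<times> ltree \<Rightarrow> (nat \<Rightarrow> nat) set \<Rightarrow> bool" where
  "Delta_code m D A \<longleftrightarrow> m \<ge> 1 \<and> Sigma_code m (fst D) A \<and> Pi_code m (snd D) A"

primrec clopen_label_encode :: "clopen_label \<Rightarrow> nat" where
  "clopen_label_encode Empty = prod_encode (0, 0)"
| "clopen_label_encode Full = prod_encode (1, 0)"
| "clopen_label_encode (Cyl \<sigma>) = prod_encode (2, list_encode \<sigma>)"
| "clopen_label_encode (CoCyl \<sigma>) = prod_encode (3, list_encode \<sigma>)"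

primrec label_encode :: "label \<Rightarrow> nat" where
  "label_encode Cup = 0"
| "label_encode Cap = 1"
| "label_encode (Leaf c) = 2 + clopen_label_encode c"

text \<open>The value 0 signals that the given sequence is not a node, so the node set of a computable
  labeled tree is decidable.\<close>

definition computable_ltree :: "ltree \<Rightarrow> bool" where
  "computable_ltree T \<longleftrightarrow> computable 1
    (\<lambda>xs. case T (list_decode (xs ! 0)) of None \<Rightarrow> 0 | Some l \<Rightarrow> Suc (label_encode l))"

definition has_computable_Delta_code :: "nat \<Rightarrow> (nat \<Rightarrow> nat) set \<Rightarrow> bool" where
  "has_computable_Delta_code m A \<longleftrightarrow>
    (\<exists>D. computable_ltree (fst D) \<and> computable_ltree (snd D) \<and> Delta_code m D A)"

end

theory Submission
  imports Defs "HOL-Library.Sublist"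
begin

text \<open>
  Membership in a Borel set coded by a tree of finite rank is decided, for a sufficiently generic
  element of \<open>(\<omega>)\<^sup>2\<close>, by a finite initial segment: for a computable code of rank \<open>n\<close>
  the relation that a string forces membership is \<open>\<Sigma>\<^sup>0\<^sub>n\<close>, and the dense sets to be met are uniformly
  \<open>\<Delta>\<^sup>0\<^sub>n\<close>. A generic element extending \<open>0\<^sup>m1\<close> lies in some \<open>C\<^sub>i\<close>, so one colour \<open>i\<close> is forced by an
  extension of \<open>0\<^sup>m1\<close> for infinitely many \<open>m\<close>. A \<open>\<Delta>\<^sup>0\<^sub>n\<close> search then builds \<open>p\<close> in stages: stage
  \<open>s\<close> opens block \<open>s + 1\<close> so that every coarsening whose first nonzero block is \<open>s + 1\<close> starts with a
  string forcing colour \<open>i\<close>, and extends the result until the images under all finite colourings of the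
  existing blocks lie in the first \<open>s + 1\<close> dense sets. All of \<open>(p)\<^sup>2\<close> is then generic and of colour
  \<open>i\<close>.
\<close>

section \<open>Classes of functions closed under recursion\<close>

text \<open>Continuum many coarsenings must be treated together. One that is not constant on the
  existing blocks has a block of each colour at its disposal, so its image can be extended to any
  longer binary string without opening a block, and finitely many colourings can be served one after
  another. One that is still constantly 0 has only zeros as its image, whatever is written with old
  blocks. Its colour can be settled only when its first nonzero block opens, by a string with at
  least as many leading zeros as the current string is long; hence the demand for infinitely many
  \<open>m\<close>. Later blocks do not occur at that moment, so one string serves all coarsenings
  with that first nonzero block.

  The levels fit because genericity only has to settle statements of rank below \<open>n\<close>: at
  the root, forcing is existential, and a generic element of a union has an initial segment
  witnessing membership. Forcing at the root is given as a \<open>\<Sigma>\<^sup>0\<^sub>n\<close>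
  relation, so the search guesses the witness of its outer quantifier along with the string, which
  leaves a \<open>\<Delta>\<^sup>0\<^sub>n\<close> test.\<close>

named_theorems cfi

text \<open>Kept abstract to serve two classes, the total recursive and the total
  \<open>\<Delta>\<^sup>0\<^sub>n\<^sub>+\<^sub>1\<close> functions. Minimisation is restricted to
  searches that succeed on every argument list of the right length.\<close>

locale function_class =
  fixes cf :: "nat \<Rightarrow> (nat list \<Rightarrow> nat) \<Rightarrow> bool"
  assumes cf_cong: "cf k F \<Longrightarrow> (\<And>xs. length xs = k \<Longrightarrow> F xs = G xs) \<Longrightarrow> cf k G"
    and cf_zero: "cf k (\<lambda>xs. 0)"
    and cf_nth: "i < k \<Longrightarrow> cf k (\<lambda>xs. xs ! i)"
    and cf_Suc: "cf k F \<Longrightarrow> cf k (\<lambda>xs. Suc (F xs))"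
    and cf_comp: "cf (length Gs) F \<Longrightarrow> \<forall>G\<in>set Gs. cf k G
      \<Longrightarrow> cf k (\<lambda>xs. F (map (\<lambda>G. G xs) Gs))"
    and cf_primrec: "cf k F \<Longrightarrow> cf (Suc (Suc k)) G
      \<Longrightarrow> cf (Suc k) (\<lambda>xs. rec_nat (F (tl xs)) (\<lambda>m y. G (m # y # tl xs)) (hd xs))"
    and cf_Least_zero: "cf (Suc k) F \<Longrightarrow> (\<And>xs. length xs = k \<Longrightarrow> \<exists>m. F (m # xs) = 0)
      \<Longrightarrow> cf k (\<lambda>xs. LEAST m. F (m # xs) = 0)"
begin

definition rel :: "nat \<Rightarrow> (nat list \<Rightarrow> bool) \<Rightarrow> bool" where
  "rel k R \<longleftrightarrow> cf k (\<lambda>xs. if R xs then 1 else 0)"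

lemma cf_subst1:
  assumes "cf 1 (\<lambda>xs. f (xs ! 0))" "cf k F"
  shows "cf k (\<lambda>xs. f (F xs))"
  using cf_comp[of "[F]" "\<lambda>xs. f (xs ! 0)" k] assms by simp

lemma cf_subst2:
  assumes "cf 2 (\<lambda>xs. f (xs ! 0) (xs ! 1))" "cf k F" "cf k G"
  shows "cf k (\<lambda>xs. f (F xs) (G xs))"
  using cf_comp[of "[F, G]" "\<lambda>xs. f (xs ! 0) (xs ! 1)" k] assms by (simp add: numeral_2_eq_2)

lemma cf_subst3:
  assumes "cf 3 (\<lambda>xs. f (xs ! 0) (xs ! 1) (xs ! 2))" "cf k F" "cf k G" "cf k H"
  shows "cf k (\<lambda>xs. f (F xs) (G xs) (H xs))"
  using cf_comp[of "[F, G, H]" "\<lambda>xs. f (xs ! 0) (xs ! 1) (xs ! 2)" k] assms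
  by (simp add: numeral_3_eq_3 numeral_2_eq_2)

lemma rel_subst1:
  assumes "rel 1 (\<lambda>xs. P (xs ! 0))" "cf k F"
  shows "rel k (\<lambda>xs. P (F xs))"
  using cf_subst1[of "\<lambda>a. if P a then 1 else 0" k F] assms unfolding rel_def by simp

lemma rel_subst2:
  assumes "rel 2 (\<lambda>xs. P (xs ! 0) (xs ! 1))" "cf k F" "cf k G"
  shows "rel k (\<lambda>xs. P (F xs) (G xs))"
  using cf_subst2[of "\<lambda>a b. if P a b then 1 else 0" k F] assms unfolding rel_def by simp

lemma rel_subst3:
  assumes "rel 3 (\<lambda>xs. P (xs ! 0) (xs ! 1) (xs ! 2))" "cf k F" "cf k G" "cf k H"
  shows "rel k (\<lambda>xs. P (F xs) (G xs) (H xs))"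
  using cf_subst3[of "\<lambda>a b c. if P a b c then 1 else 0" k F] assms unfolding rel_def by simp

lemma rel_cong: "rel k R \<Longrightarrow> (\<And>xs. length xs = k \<Longrightarrow> R xs = S xs) \<Longrightarrow> rel k S"
  unfolding rel_def by (erule cf_cong) simp

lemma cf_tl: "cf k F \<Longrightarrow> cf (Suc k) (\<lambda>xs. F (tl xs))"
proof -
  assume "cf k F"
  then have "cf (Suc k) (\<lambda>xs. F (map (\<lambda>G. G xs) (map (\<lambda>i xs. xs ! Suc i) [0..<k])))"
    by (intro cf_comp) (auto intro!: cf_nth)
  moreover have "map (\<lambda>G. G xs) (map (\<lambda>i xs. xs ! Suc i) [0..<k]) = tl xs"
    if "length xs = Suc k" for xs :: "nat list"
    using that by (auto intro!: nth_equalityI simp: nth_tl)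
  ultimately show ?thesis
    by (elim cf_cong) simp
qed

lemma cf_tl_nth:
  "Suc i < k \<Longrightarrow> cf k (\<lambda>xs. tl xs ! i)"
  "Suc (Suc i) < k \<Longrightarrow> cf k (\<lambda>xs. tl (tl xs) ! i)"
  "Suc (Suc (Suc i)) < k \<Longrightarrow> cf k (\<lambda>xs. tl (tl (tl xs)) ! i)"
  "Suc (Suc (Suc (Suc i))) < k \<Longrightarrow> cf k (\<lambda>xs. tl (tl (tl (tl xs))) ! i)"
proof -
  have tl1: "cf k (\<lambda>xs. tl xs ! i)" if "Suc i < k" for k
    using cf_tl[OF cf_nth[of i "k - 1"]] that by simp
  have tl2: "cf k (\<lambda>xs. tl (tl xs) ! i)" if "Suc (Suc i) < k" for k
    using cf_tl[OF tl1[of "k - 1"]] that by simp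
  have tl3: "cf k (\<lambda>xs. tl (tl (tl xs)) ! i)" if "Suc (Suc (Suc i)) < k" for k
    using cf_tl[OF tl2[of "k - 1"]] that by simp
  have tl4: "cf k (\<lambda>xs. tl (tl (tl (tl xs))) ! i)" if "Suc (Suc (Suc (Suc i))) < k" for k
    using cf_tl[OF tl3[of "k - 1"]] that by simp
  show "Suc i < k \<Longrightarrow> cf k (\<lambda>xs. tl xs ! i)"
    "Suc (Suc i) < k \<Longrightarrow> cf k (\<lambda>xs. tl (tl xs) ! i)"
    "Suc (Suc (Suc i)) < k \<Longrightarrow> cf k (\<lambda>xs. tl (tl (tl xs)) ! i)"
    "Suc (Suc (Suc (Suc i))) < k \<Longrightarrow> cf k (\<lambda>xs. tl (tl (tl (tl xs))) ! i)"
    by (fact tl1 tl2 tl3 tl4)+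
qed

lemma cf_const: "cf k (\<lambda>xs. c)"
  by (induction c) (auto intro: cf_zero cf_Suc)

text \<open>\<open>cf_primrec\<close> separates the recursion argument from the parameters. Feeding
  it \<open>H xs # xs\<close> lets the number of iterations depend on the parameters.\<close>

lemma cf_rec_nat:
  assumes F: "cf k F" and G: "cf (Suc (Suc k)) (\<lambda>ys. G (ys ! 0) (ys ! 1) (tl (tl ys)))" and H: "cf k H"
  shows "cf k (\<lambda>xs. rec_nat (F xs) (\<lambda>m y. G m y xs) (H xs))"
proof -
  define Gs where "Gs = H # map (\<lambda>i xs. xs ! i) [0..<k]"
  have "cf (length Gs) (\<lambda>xs. rec_nat (F (tl xs)) (\<lambda>m y. G m y (tl xs)) (hd xs))"
    using cf_primrec[OF F G] by (simp add: Gs_def)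
  then have *: "cf k (\<lambda>xs. (\<lambda>xs. rec_nat (F (tl xs)) (\<lambda>m y. G m y (tl xs)) (hd xs)) (map (\<lambda>G. G xs) Gs))"
    by (rule cf_comp) (auto simp: Gs_def H intro!: cf_nth)
  show ?thesis
  proof (rule cf_cong[OF *])
    fix xs :: "nat list"
    assume "length xs = k"
    then have "map (\<lambda>G. G xs) Gs = H xs # xs"
      by (auto simp: Gs_def intro: nth_equalityI)
    then show "(\<lambda>xs. rec_nat (F (tl xs)) (\<lambda>m y. G m y (tl xs)) (hd xs)) (map (\<lambda>G. G xs) Gs)
      = rec_nat (F xs) (\<lambda>m y. G m y xs) (H xs)" by simp
  qed
qed

lemmas [cfi] = cf_const cf_nth cf_Suc cf_tl_nth cf_rec_nat

lemma cf_plus [cfi]: assumes "cf k F" "cf k G" shows "cf k (\<lambda>xs. F xs + G xs)"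
proof -
  have "rec_nat a (\<lambda>m y. Suc y) b = a + b" for a b :: nat by (induction b) auto
  moreover have "cf 2 (\<lambda>xs. rec_nat (xs ! 0) (\<lambda>m y. Suc y) (xs ! 1))" by (intro cfi) simp_all
  ultimately show ?thesis
    using cf_subst2[of "\<lambda>a b. a + b", OF _ assms] by simp
qed

lemma cf_times [cfi]: assumes "cf k F" "cf k G" shows "cf k (\<lambda>xs. F xs * G xs)"
proof -
  have "rec_nat 0 (\<lambda>m y. y + a) b = a * b" for a b :: nat by (induction b) auto
  moreover have "cf 2 (\<lambda>xs. rec_nat 0 (\<lambda>m y. y + xs ! 0) (xs ! 1))" by (intro cfi) simp_all
  ultimately show ?thesis
    using cf_subst2[of "\<lambda>a b. a * b", OF _ assms] by simp
qed

lemma cf_minus [cfi]: assumes "cf k F" "cf k G" shows "cf k (\<lambda>xs. F xs - G xs)"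
proof -
  have p: "rec_nat 0 (\<lambda>m y. m) a = a - 1" for a :: nat by (cases a) auto
  have m: "rec_nat a (\<lambda>m y. rec_nat 0 (\<lambda>m y. m) y) b = a - b" for a b :: nat
    unfolding p by (induction b) auto
  have "cf 2 (\<lambda>xs. rec_nat (xs ! 0) (\<lambda>m y. rec_nat 0 (\<lambda>m y. m) y) (xs ! 1))"
    by (intro cfi) simp_all
  with m show ?thesis
    using cf_subst2[of "\<lambda>a b. a - b", OF _ assms] by simp
qed

lemma rel_eq_0: "cf k F \<Longrightarrow> rel k (\<lambda>xs. F xs = 0)"
proof -
  assume "cf k F"
  then have "cf k (\<lambda>xs. 1 - F xs)" by (intro cfi)
  then show ?thesis unfolding rel_def by (rule cf_cong) auto
qed

lemma cf_if [cfi]: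
  assumes "rel k R" "cf k F" "cf k G" shows "cf k (\<lambda>xs. if R xs then F xs else G xs)"
proof -
  have "cf k (\<lambda>xs. (if R xs then 1 else 0) * F xs + (1 - (if R xs then 1 else 0)) * G xs)"
    using assms unfolding rel_def by (intro cfi)
  then show ?thesis by (rule cf_cong) auto
qed

lemma rel_const [cfi]: "rel k (\<lambda>xs. b)"
  unfolding rel_def by (rule cf_const)

lemma rel_not [cfi]: "rel k R \<Longrightarrow> rel k (\<lambda>xs. \<not> R xs)"
proof -
  assume R: "rel k R"
  have "cf k (\<lambda>xs. if R xs then 0 else 1)" using R by (intro cf_if cf_const)
  then show ?thesis unfolding rel_def by (rule cf_cong) simp
qed

lemma rel_and [cfi]: "rel k R \<Longrightarrow> rel k S \<Longrightarrow> rel k (\<lambda>xs. R xs \<and> S xs)"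
proof -
  assume R: "rel k R" and S: "rel k S"
  have "cf k (\<lambda>xs. if R xs then if S xs then 1 else 0 else 0)"
    using R S by (intro cf_if cf_const)
  then show ?thesis unfolding rel_def by (rule cf_cong) simp
qed

lemma rel_or [cfi]: "rel k R \<Longrightarrow> rel k S \<Longrightarrow> rel k (\<lambda>xs. R xs \<or> S xs)"
  using rel_not[OF rel_and[OF rel_not rel_not], of k R S] by simp

lemma rel_imp [cfi]: "rel k R \<Longrightarrow> rel k S \<Longrightarrow> rel k (\<lambda>xs. R xs \<longrightarrow> S xs)"
  using rel_or[OF rel_not, of k R S] by (simp only: imp_conv_disj)

lemma rel_le [cfi]: "cf k F \<Longrightarrow> cf k G \<Longrightarrow> rel k (\<lambda>xs. F xs \<le> G xs)"
  using rel_eq_0[OF cf_minus, of k F G] by simp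

lemma rel_less [cfi]: "cf k F \<Longrightarrow> cf k G \<Longrightarrow> rel k (\<lambda>xs. F xs < G xs)"
  using rel_not[OF rel_le, of k G F] by (simp add: not_le)

lemma rel_eq [cfi]: "cf k F \<Longrightarrow> cf k G \<Longrightarrow> rel k (\<lambda>xs. F xs = G xs)"
  using rel_and[OF rel_le rel_le, of k F G G F] by (simp add: eq_iff)

lemma rel_Ex_less [cfi]:
  assumes "cf k H" "rel (Suc k) (\<lambda>ys. P (ys ! 0) (tl ys))"
  shows "rel k (\<lambda>xs. \<exists>m<H xs. P m xs)"
proof -
  have *: "cf (Suc (Suc k)) (\<lambda>ys. if P (ys ! 0) (tl (tl ys)) then 1 else ys ! 1)"
  proof (intro cf_if cfi)
    have "rel (Suc (Suc k)) (\<lambda>ys. (\<lambda>ys. P (ys ! 0) (tl ys)) (map (\<lambda>G. G ys)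
      ((\<lambda>ys. ys ! 0) # map (\<lambda>i ys. ys ! Suc (Suc i)) [0..<k])))"
      using assms(2) unfolding rel_def
      by (intro cf_comp[of _ "\<lambda>xs. if P (xs ! 0) (tl xs) then 1 else 0", simplified]) (auto intro!: cf_nth)
    then show "rel (Suc (Suc k)) (\<lambda>ys. P (ys ! 0) (tl (tl ys)))"
    proof (rule rel_cong)
      fix ys :: "nat list" assume "length ys = Suc (Suc k)"
      then have "map (\<lambda>G. G ys) ((\<lambda>ys. ys ! 0) # map (\<lambda>i ys. ys ! Suc (Suc i)) [0..<k]) = ys ! 0 # tl (tl ys)"
        by (auto intro!: nth_equalityI simp: nth_tl)
      then show "P (map (\<lambda>G. G ys) ((\<lambda>ys. ys ! 0) # map (\<lambda>i ys. ys ! Suc (Suc i)) [0..<k]) ! 0)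
          (tl (map (\<lambda>G. G ys) ((\<lambda>ys. ys ! 0) # map (\<lambda>i ys. ys ! Suc (Suc i)) [0..<k])))
          = P (ys ! 0) (tl (tl ys))"
        by simp
    qed
  qed auto
  have "rec_nat 0 (\<lambda>m y. if P m xs then 1 else y) h = (if \<exists>m<h. P m xs then 1 else 0 :: nat)" for h xs
    by (induction h) (auto simp: less_Suc_eq)
  then show ?thesis
    using cf_rec_nat[OF cf_const * assms(1), of 0] unfolding rel_def by simp
qed

lemma rel_All_less [cfi]:
  assumes "cf k H" "rel (Suc k) (\<lambda>ys. P (ys ! 0) (tl ys))"
  shows "rel k (\<lambda>xs. \<forall>m<H xs. P m xs)"
  using rel_not[OF rel_Ex_less[OF assms(1) rel_not[OF assms(2)]]] by simp

lemma cf_Least: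
  assumes "rel (Suc k) (\<lambda>ys. P (ys ! 0) (tl ys))" "\<And>xs. length xs = k \<Longrightarrow> \<exists>m. P m xs"
  shows "cf k (\<lambda>xs. LEAST m. P m xs)"
proof -
  have "cf k (\<lambda>xs. LEAST m. (\<lambda>ys. if \<not> P (ys ! 0) (tl ys) then 1 else 0 :: nat) (m # xs) = 0)"
    using assms rel_not unfolding rel_def by (intro cf_Least_zero) auto
  then show ?thesis by (rule cf_cong) auto
qed

end

section \<open>The total recursive functions as such a class\<close>

lemma computable_comp:
  assumes F: "computable (length Gs) F" and Gs: "\<forall>G\<in>set Gs. computable k G"
  shows "computable k (\<lambda>xs. F (map (\<lambda>G. G xs) Gs))"
proof -
  obtain f where f: "\<And>ys. length ys = length Gs \<Longrightarrow> rec_eval f ys (F ys)"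
    using F unfolding computable_def by auto
  have "\<forall>G. \<exists>g. G \<in> set Gs \<longrightarrow> (\<forall>xs. length xs = k \<longrightarrow> rec_eval g xs (G xs))"
    using Gs unfolding computable_def by auto
  then obtain c where c: "\<And>G xs. G \<in> set Gs \<Longrightarrow> length xs = k \<Longrightarrow> rec_eval (c G) xs (G xs)"
    by metis
  have "rec_eval (Comp f (map c Gs)) xs (F (map (\<lambda>G. G xs) Gs))" if "length xs = k" for xs
    by (rule rec_eval.intros(4)[OF _ f]) (auto simp: list_all2_conv_all_nth c that)
  then show ?thesis unfolding computable_def by blast
qed

lemma computable_primrec:
  assumes "computable k F" "computable (Suc (Suc k)) G"
  shows "computable (Suc k) (\<lambda>xs. rec_nat (F (tl xs)) (\<lambda>m y. G (m # y # tl xs)) (hd xs))"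
proof -
  obtain f where f: "\<And>xs. length xs = k \<Longrightarrow> rec_eval f xs (F xs)"
    using assms(1) unfolding computable_def by auto
  obtain g where g: "\<And>xs. length xs = Suc (Suc k) \<Longrightarrow> rec_eval g xs (G xs)"
    using assms(2) unfolding computable_def by auto
  have "rec_eval (PrimRec f g) (m # xs) (rec_nat (F xs) (\<lambda>m y. G (m # y # xs)) m)"
    if "length xs = k" for m xs
  proof (induction m)
    case 0
    then show ?case using f[OF that] by (auto intro: rec_eval.intros)
  next
    case (Suc m)
    then show ?case using g[of "m # rec_nat (F xs) (\<lambda>m y. G (m # y # xs)) m # xs"] that
      by (auto intro: rec_eval.intros(6))
  qed
  then show ?thesis unfolding computable_def
    by (intro exI[of _ "PrimRec f g"]) (auto simp: length_Suc_conv)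
qed

lemma computable_Least_zero:
  assumes "computable (Suc k) F" and ex: "\<And>xs. length xs = k \<Longrightarrow> \<exists>m. F (m # xs) = 0"
  shows "computable k (\<lambda>xs. LEAST m. F (m # xs) = 0)"
proof -
  obtain f where f: "\<And>xs. length xs = Suc k \<Longrightarrow> rec_eval f xs (F xs)"
    using assms(1) unfolding computable_def by auto
  have "rec_eval (Mu f) xs (LEAST m. F (m # xs) = 0)" if k: "length xs = k" for xs
  proof (rule rec_eval.intros(7))
    have "F ((LEAST m. F (m # xs) = 0) # xs) = 0"
      using ex[OF k] by (rule LeastI_ex)
    with f[of "(LEAST m. F (m # xs) = 0) # xs"] k
    show "rec_eval f ((LEAST m. F (m # xs) = 0) # xs) 0" by simp
    show "\<forall>i<LEAST m. F (m # xs) = 0. \<exists>y. rec_eval f (i # xs) (Suc y)"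
    proof (intro allI impI)
      fix i assume "i < (LEAST m. F (m # xs) = 0)"
      then have "F (i # xs) \<noteq> 0" by (rule not_less_Least)
      then obtain y where "F (i # xs) = Suc y" by (cases "F (i # xs)") auto
      with f[of "i # xs"] k show "\<exists>y. rec_eval f (i # xs) (Suc y)" by auto
    qed
  qed
  then show ?thesis unfolding computable_def by blast
qed

global_interpretation computable: function_class computable
  rewrites "function_class.rel computable = decidable"
proof -
  show fc: "function_class computable"
  proof
    show "computable k F \<Longrightarrow> (\<And>xs. length xs = k \<Longrightarrow> F xs = G xs) \<Longrightarrow> computable k G" for k F G
      unfolding computable_def by metis
    show "computable k (\<lambda>xs. 0)" for k
      unfolding computable_def by (blast intro: rec_eval.intros)
    show "i < k \<Longrightarrow> computable k (\<lambda>xs. xs ! i)" for i k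
      unfolding computable_def by (blast intro: rec_eval.intros)
    show "computable k (\<lambda>xs. Suc (F xs))" if "computable k F" for k F
    proof -
      have "computable 1 (\<lambda>xs. Suc (xs ! 0))"
        unfolding computable_def
        by (intro exI[of _ Succ]) (auto simp: length_Suc_conv intro: rec_eval.intros)
      with that show ?thesis
        using computable_comp[of "[F]" "\<lambda>xs. Suc (xs ! 0)" k] by simp
    qed
  qed (fact computable_comp computable_primrec computable_Least_zero)+
  show "function_class.rel computable = decidable"
    by (intro ext) (simp add: function_class.rel_def[OF fc] decidable_def)
qed

section \<open>Coded pairs and lists\<close>

definition pfst :: "nat \<Rightarrow> nat" where "pfst c = fst (prod_decode c)"
definition psnd :: "nat \<Rightarrow> nat" where "psnd c = snd (prod_decode c)"
definition ldrop :: "nat \<Rightarrow> nat \<Rightarrow> nat" where "ldrop i c = list_encode (drop i (list_decode c))"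

text \<open>For \<open>i\<close> beyond the end of the list, \<open>lnth c i = 0\<close>.\<close>

definition lnth :: "nat \<Rightarrow> nat \<Rightarrow> nat" where "lnth c i = pfst (ldrop i c - 1)"
definition llen :: "nat \<Rightarrow> nat" where "llen c = length (list_decode c)"
definition lprefix :: "nat \<Rightarrow> nat \<Rightarrow> bool" where
  "lprefix c d \<longleftrightarrow> prefix (list_decode c) (list_decode d)"

lemma pfst_encode [simp]: "pfst (prod_encode (a, b)) = a"
  and psnd_encode [simp]: "psnd (prod_encode (a, b)) = b"
  by (simp_all add: pfst_def psnd_def)

lemma prod_encode_pfst_psnd [simp]: "prod_encode (pfst c, psnd c) = c"
  by (simp add: pfst_def psnd_def)

text \<open>The empty list has code 0 and \<open>psnd 0 = 0\<close>, so the step stays correct past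
  the end of a list and can be iterated to compute \<open>ldrop\<close> without case
  distinction.\<close>

lemma psnd_list_encode: "psnd (list_encode xs - Suc 0) = list_encode (tl xs)"
proof -
  have "prod_encode (0, 0) = 0" by (simp add: prod_encode_def)
  then have "psnd 0 = 0" by (metis psnd_encode)
  then show ?thesis by (cases xs) simp_all
qed

lemma ldrop_rec: "rec_nat c (\<lambda>m y. psnd (y - 1)) i = ldrop i c"
  by (induction i) (simp_all add: ldrop_def drop_Suc tl_drop psnd_list_encode)

lemma ldrop_eq_0_iff: "ldrop i c = 0 \<longleftrightarrow> llen c \<le> i"
proof -
  have "list_encode xs = 0 \<longleftrightarrow> xs = []" for xs by (cases xs) auto
  then show ?thesis by (simp add: ldrop_def llen_def)
qed

lemma lnth_eq: "i < llen c \<Longrightarrow> lnth c i = list_decode c ! i"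
  by (simp add: lnth_def ldrop_def llen_def flip: Cons_nth_drop_Suc)

lemma lnth_encode [simp]: "i < length xs \<Longrightarrow> lnth (list_encode xs) i = xs ! i"
  by (simp add: lnth_eq llen_def)

lemma llen_encode [simp]: "llen (list_encode xs) = length xs"
  by (simp add: llen_def)

lemma llen_eq_Least: "llen c = (LEAST i. ldrop i c = 0)"
  by (auto simp: ldrop_eq_0_iff intro!: Least_equality[symmetric])

lemma lprefix_iff: "lprefix c d \<longleftrightarrow> llen c \<le> llen d \<and> (\<forall>i<llen c. lnth c i = lnth d i)"
proof -
  have "prefix xs ys \<longleftrightarrow> length xs \<le> length ys \<and> (\<forall>i<length xs. xs ! i = ys ! i)" for xs ys :: "nat list"
  proof
    assume *: "length xs \<le> length ys \<and> (\<forall>i<length xs. xs ! i = ys ! i)"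
    then have "xs = take (length xs) ys" by (auto intro: nth_equalityI)
    then show "prefix xs ys" by (metis take_is_prefix)
  qed (auto simp: prefix_def nth_append)
  then show ?thesis by (auto simp: lprefix_def lnth_eq llen_def)
qed

text \<open>Finitely many witnesses fit into one number; this is how an existential quantifier moves
  in front of a bounded universal one.\<close>

lemma lnth_choice: "\<exists>c. \<forall>i<n. lnth c i = f i"
  by (rule exI[of _ "list_encode (map f [0..<n])"]) simp

context function_class
begin

lemma cf_prod_encode [cfi]:
  assumes "cf k F" "cf k G" shows "cf k (\<lambda>xs. prod_encode (F xs, G xs))"
proof -
  have "rec_nat 0 (\<lambda>m y. y + Suc m) n = triangle n" for n by (induction n) auto
  then have "prod_encode (a, b) = rec_nat 0 (\<lambda>m y. y + Suc m) (a + b) + a" for a b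
    by (simp add: prod_encode_def)
  moreover have "cf k (\<lambda>xs. rec_nat 0 (\<lambda>m y. y + Suc m) (F xs + G xs) + F xs)"
    by (intro cfi assms) simp_all
  ultimately show ?thesis by simp
qed

lemma cf_pfst [cfi]: assumes "cf k F" shows "cf k (\<lambda>xs. pfst (F xs))"
proof -
  have ex: "b < Suc c" if "prod_encode (a, b) = c" for a b c
    using le_prod_encode_2[of b a] that by simp
  have "pfst c = (LEAST a. \<exists>b<Suc c. prod_encode (a, b) = c)" for c
    by (rule Least_equality[symmetric]) (use ex prod_encode_pfst_psnd in \<open>blast, auto\<close>)
  moreover have "cf 1 (\<lambda>xs. LEAST a. \<exists>b<Suc (xs ! 0). prod_encode (a, b) = xs ! 0)"
    by (intro cf_Least cfi) (simp_all, metis ex prod_encode_pfst_psnd)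
  ultimately show ?thesis using cf_subst1[of pfst, OF _ assms] by simp
qed

lemma cf_psnd [cfi]: assumes "cf k F" shows "cf k (\<lambda>xs. psnd (F xs))"
proof -
  have ex: "a < Suc c" if "prod_encode (a, b) = c" for a b c
    using le_prod_encode_1[of a b] that by simp
  have "psnd c = (LEAST b. \<exists>a<Suc c. prod_encode (a, b) = c)" for c
    by (rule Least_equality[symmetric]) (use ex prod_encode_pfst_psnd in \<open>blast, auto\<close>)
  moreover have "cf 1 (\<lambda>xs. LEAST b. \<exists>a<Suc (xs ! 0). prod_encode (a, b) = xs ! 0)"
    by (intro cf_Least cfi) (simp_all, metis ex prod_encode_pfst_psnd)
  ultimately show ?thesis using cf_subst1[of psnd, OF _ assms] by simp
qed

lemma cf_ldrop [cfi]: "cf k F \<Longrightarrow> cf k G \<Longrightarrow> cf k (\<lambda>xs. ldrop (F xs) (G xs))"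
  unfolding ldrop_rec[symmetric] by (intro cfi) simp_all

lemma cf_lnth [cfi]: "cf k F \<Longrightarrow> cf k G \<Longrightarrow> cf k (\<lambda>xs. lnth (F xs) (G xs))"
  unfolding lnth_def by (intro cfi)

lemma cf_llen [cfi]: assumes "cf k F" shows "cf k (\<lambda>xs. llen (F xs))"
proof -
  have "cf 1 (\<lambda>xs. llen (xs ! 0))"
    unfolding llen_eq_Least by (intro cf_Least cfi) (auto simp: ldrop_eq_0_iff)
  then show ?thesis using cf_subst1[of llen, OF _ assms] by simp
qed

lemma rel_lprefix [cfi]: assumes "cf k F" "cf k G" shows "rel k (\<lambda>xs. lprefix (F xs) (G xs))"
proof -
  have "rel 2 (\<lambda>xs. lprefix (xs ! 0) (xs ! 1))"
    unfolding lprefix_iff by (intro cfi) simp_all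
  then show ?thesis using rel_subst2[of lprefix, OF _ assms] by simp
qed

lemma cf_uniqueI:
  assumes "rel (Suc k) (\<lambda>ys. P (ys ! 0) (tl ys))"
    and "\<And>c xs. length xs = k \<Longrightarrow> P c xs \<longleftrightarrow> c = F xs"
  shows "cf k F"
proof -
  have "cf k (\<lambda>xs. LEAST c. P c xs)"
    using assms by (intro cf_Least) auto
  then show ?thesis by (rule cf_cong) (auto simp: assms(2) intro: Least_equality)
qed

end

section \<open>The arithmetical hierarchy\<close>

lemma (in function_class) cf_subst_list:
  assumes "cf m F" "\<And>i. i < m \<Longrightarrow> cf k (\<lambda>xs. H xs ! i)" "\<And>xs. length xs = k \<Longrightarrow> length (H xs) = m"
  shows "cf k (\<lambda>xs. F (H xs))"
proof -
  define Gs where "Gs = map (\<lambda>i xs. H xs ! i) [0..<m]"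
  have "cf k (\<lambda>xs. F (map (\<lambda>G. G xs) Gs))"
    using assms by (intro cf_comp) (auto simp: Gs_def)
  moreover have "map (\<lambda>G. G xs) Gs = H xs" if "length xs = k" for xs
    using assms(3)[OF that] by (auto intro!: nth_equalityI simp: Gs_def)
  ultimately show ?thesis by (elim cf_cong) simp
qed

text \<open>\<open>clist k m H\<close>: \<open>H\<close> is a substitution of \<open>m\<close> computable functions into an \<open>m\<close>-ary relation.\<close>

definition clist :: "nat \<Rightarrow> nat \<Rightarrow> (nat list \<Rightarrow> nat list) \<Rightarrow> bool" where
  "clist k m H \<longleftrightarrow> (\<forall>i<m. computable k (\<lambda>xs. H xs ! i)) \<and> (\<forall>xs. length xs = k \<longrightarrow> length (H xs) = m)"

lemma clist_Nil [cfi]: "clist k 0 (\<lambda>xs. [])"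
  by (simp add: clist_def)

lemma clist_Cons [cfi]:
  assumes "computable k F" "clist k m H" shows "clist k (Suc m) (\<lambda>xs. F xs # H xs)"
proof -
  have "computable k (\<lambda>xs. (F xs # H xs) ! i)" if "i < Suc m" for i
    using assms that by (cases i) (simp_all add: clist_def)
  with assms show ?thesis by (simp add: clist_def)
qed

lemma clist_tl [cfi]:
  "k = Suc m \<Longrightarrow> clist k m (\<lambda>xs. tl xs)"
  "k = Suc (Suc m) \<Longrightarrow> clist k m (\<lambda>xs. tl (tl xs))"
  "k = Suc (Suc (Suc m)) \<Longrightarrow> clist k m (\<lambda>xs. tl (tl (tl xs)))"
  "k = Suc (Suc (Suc (Suc m))) \<Longrightarrow> clist k m (\<lambda>xs. tl (tl (tl (tl xs))))"
  by (simp_all add: clist_def computable.cf_tl_nth)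

lemma Sigma0_cong:
  assumes "Sigma0 n k R" "\<And>xs. length xs = k \<Longrightarrow> R xs = S xs"
  shows "Sigma0 n k S"
proof (cases n)
  case 0
  then show ?thesis using assms computable.rel_cong by simp
next
  case (Suc m)
  then show ?thesis using assms by auto
qed

lemma Sigma0_subst:
  assumes "Sigma0 n m R" "clist k m H"
  shows "Sigma0 n k (\<lambda>xs. R (H xs))"
  using assms
proof (induction n arbitrary: m k R H)
  case 0
  then show ?case
    using computable.cf_subst_list[of m "\<lambda>xs. if R xs then 1 else 0" k H]
    by (simp add: decidable_def clist_def)
next
  case (Suc n)
  then obtain Q where Q: "Sigma0 n (Suc m) Q" "\<And>xs. length xs = m \<Longrightarrow> R xs \<longleftrightarrow> (\<exists>y. \<not> Q (y # xs))"
    by auto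
  have "Sigma0 n (Suc k) (\<lambda>ys. Q (ys ! 0 # H (tl ys)))"
  proof (rule Suc.IH[OF Q(1)])
    have "clist (Suc k) m (\<lambda>ys. H (tl ys))"
      using Suc.prems(2) computable.cf_tl[of k "\<lambda>xs. H xs ! i" for i] by (auto simp: clist_def)
    then show "clist (Suc k) (Suc m) (\<lambda>ys. ys ! 0 # H (tl ys))"
      by (intro cfi) simp_all
  qed
  with Q(2) Suc.prems(2) show ?case
    by (auto intro!: exI[of _ "\<lambda>ys. Q (ys ! 0 # H (tl ys))"] simp: clist_def)
qed

lemma Pi0_cong:
  assumes "Pi0 n k R" "\<And>xs. length xs = k \<Longrightarrow> R xs = S xs"
  shows "Pi0 n k S"
  using assms unfolding Pi0_def by (elim Sigma0_cong) simp

lemma Pi0_subst: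
  assumes "Pi0 n m R" "clist k m H"
  shows "Pi0 n k (\<lambda>xs. R (H xs))"
  using assms unfolding Pi0_def by (rule Sigma0_subst)

lemma Pi0_not: "Sigma0 n k R \<Longrightarrow> Pi0 n k (\<lambda>xs. \<not> R xs)"
  by (simp add: Pi0_def)

lemma Sigma0_not: "Pi0 n k R \<Longrightarrow> Sigma0 n k (\<lambda>xs. \<not> R xs)"
  by (simp add: Pi0_def)

lemma Sigma0_SucI:
  assumes "Pi0 n (Suc k) (\<lambda>ys. P (ys ! 0) (tl ys))"
  shows "Sigma0 (Suc n) k (\<lambda>xs. \<exists>y. P y xs)"
  using assms unfolding Pi0_def
  by (auto intro!: exI[of _ "\<lambda>ys. \<not> P (ys ! 0) (tl ys)"])

lemma Sigma0_SucE:
  assumes "Sigma0 (Suc n) k R"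
  obtains P where "Pi0 n (Suc k) (\<lambda>ys. P (ys ! 0) (tl ys))"
    "\<And>xs. length xs = k \<Longrightarrow> R xs \<longleftrightarrow> (\<exists>y. P y xs)"
proof -
  from assms obtain Q where Q: "Sigma0 n (Suc k) Q" "\<And>xs. length xs = k \<Longrightarrow> R xs \<longleftrightarrow> (\<exists>y. \<not> Q (y # xs))"
    by auto
  from Q(1) have "Pi0 n (Suc k) (\<lambda>ys. \<not> Q (ys ! 0 # tl ys))"
    unfolding Pi0_def by (rule Sigma0_cong) (auto simp: length_Suc_conv)
  with Q(2) that[of "\<lambda>y xs. \<not> Q (y # xs)"] show ?thesis by simp
qed

text \<open>Proved together because negation exchanges the connectives: a disjunction needs the
  disjunction of the \<open>\<Pi>\<close> matrices, that is, a conjunction one level down, and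
  dually. For the conjunction the two witnesses are paired.\<close>

lemma Sigma0_and_or:
  "Sigma0 n k R \<Longrightarrow> Sigma0 n k S
    \<Longrightarrow> Sigma0 n k (\<lambda>xs. R xs \<and> S xs) \<and> Sigma0 n k (\<lambda>xs. R xs \<or> S xs)"
proof (induction n arbitrary: k R S)
  case 0
  then show ?case by (simp add: computable.rel_and computable.rel_or)
next
  case (Suc n)
  obtain P where P: "Pi0 n (Suc k) (\<lambda>ys. P (ys ! 0) (tl ys))"
    "\<And>xs. length xs = k \<Longrightarrow> R xs \<longleftrightarrow> (\<exists>y. P y xs)"
    using Suc.prems(1) by (rule Sigma0_SucE) (rule that)
  obtain Q where Q: "Pi0 n (Suc k) (\<lambda>ys. Q (ys ! 0) (tl ys))"
    "\<And>xs. length xs = k \<Longrightarrow> S xs \<longleftrightarrow> (\<exists>y. Q y xs)"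
    using Suc.prems(2) by (rule Sigma0_SucE) (rule that)
  have "Pi0 n (Suc k) (\<lambda>ys. P (ys ! 0) (tl ys) \<or> Q (ys ! 0) (tl ys))"
    using Suc.IH P(1) Q(1) unfolding Pi0_def by simp
  then have "Sigma0 (Suc n) k (\<lambda>xs. \<exists>y. P y xs \<or> Q y xs)"
    by (rule Sigma0_SucI)
  moreover
  have "Pi0 n (Suc k) (\<lambda>ys. P (pfst (ys ! 0)) (tl ys))" "Pi0 n (Suc k) (\<lambda>ys. Q (psnd (ys ! 0)) (tl ys))"
    by (rule Pi0_subst[OF P(1), where H = "\<lambda>ys. pfst (ys ! 0) # tl ys", simplified]
        Pi0_subst[OF Q(1), where H = "\<lambda>ys. psnd (ys ! 0) # tl ys", simplified]; intro cfi; simp)+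
  then have "Pi0 n (Suc k) (\<lambda>ys. P (pfst (ys ! 0)) (tl ys) \<and> Q (psnd (ys ! 0)) (tl ys))"
    using Suc.IH unfolding Pi0_def de_Morgan_conj by blast
  then have "Sigma0 (Suc n) k (\<lambda>xs. \<exists>y. P (pfst y) xs \<and> Q (psnd y) xs)"
    by (rule Sigma0_SucI)
  moreover have "(\<exists>y. P y xs) \<and> (\<exists>y. Q y xs) \<longleftrightarrow> (\<exists>y. P (pfst y) xs \<and> Q (psnd y) xs)" for xs
    by (metis pfst_encode psnd_encode)
  ultimately show ?case
    using P(2) Q(2) Sigma0_cong[of "Suc n" k "\<lambda>xs. \<exists>y. P (pfst y) xs \<and> Q (psnd y) xs" "\<lambda>xs. R xs \<and> S xs"]
      Sigma0_cong[of "Suc n" k "\<lambda>xs. \<exists>y. P y xs \<or> Q y xs" "\<lambda>xs. R xs \<or> S xs"]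
    by (simp del: Sigma0.simps add: ex_disj_distrib)
qed

named_theorems sgi

lemma Sigma0_and [sgi]: "Sigma0 n k R \<Longrightarrow> Sigma0 n k S \<Longrightarrow> Sigma0 n k (\<lambda>xs. R xs \<and> S xs)"
  and Sigma0_or [sgi]: "Sigma0 n k R \<Longrightarrow> Sigma0 n k S \<Longrightarrow> Sigma0 n k (\<lambda>xs. R xs \<or> S xs)"
  using Sigma0_and_or by blast+

lemma Pi0_or [sgi]: "Pi0 n k R \<Longrightarrow> Pi0 n k S \<Longrightarrow> Pi0 n k (\<lambda>xs. R xs \<or> S xs)"
  unfolding Pi0_def de_Morgan_disj by (rule Sigma0_and)

lemmas [sgi] = Sigma0_not Pi0_not

lemma Sigma0_Pi0_mono: "Pi0 n k R \<Longrightarrow> Sigma0 (Suc n) k R"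
  using Sigma0_SucI[of n k "\<lambda>y. R"] Pi0_subst[of n k R "Suc k" tl] clist_tl(1)
  by simp

lemma Sigma0_mono: "Sigma0 n k R \<Longrightarrow> Sigma0 (Suc n) k R"
proof (induction n arbitrary: k R)
  case 0
  then have "Pi0 0 k R" by (simp add: Pi0_def computable.rel_not)
  then show ?case by (rule Sigma0_Pi0_mono)
next
  case (Suc n)
  then obtain P where P: "Pi0 n (Suc k) (\<lambda>ys. P (ys ! 0) (tl ys))"
    "\<And>xs. length xs = k \<Longrightarrow> R xs \<longleftrightarrow> (\<exists>y. P y xs)"
    by (elim Sigma0_SucE) (rule that)
  from Suc.IH P(1) have "Pi0 (Suc n) (Suc k) (\<lambda>ys. P (ys ! 0) (tl ys))"
    unfolding Pi0_def by blast
  then have "Sigma0 (Suc (Suc n)) k (\<lambda>xs. \<exists>y. P y xs)" by (rule Sigma0_SucI)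
  with P(2) show ?case by (elim Sigma0_cong) simp
qed

declare Sigma0.simps(2) [simp del]

lemma Sigma0_decidable: "decidable k R \<Longrightarrow> Sigma0 n k R"
  by (induction n) (simp_all add: Sigma0_mono)

lemma Pi0_decidable: "decidable k R \<Longrightarrow> Pi0 n k R"
  unfolding Pi0_def by (intro Sigma0_decidable computable.rel_not)

lemma Sigma0_Ex [sgi]:
  assumes "Sigma0 (Suc n) (Suc k) (\<lambda>ys. P (ys ! 0) (tl ys))"
  shows "Sigma0 (Suc n) k (\<lambda>xs. \<exists>y. P y xs)"
proof -
  obtain Q where Q: "Pi0 n (Suc (Suc k)) (\<lambda>ys. Q (ys ! 0) (tl ys))"
    "\<And>xs. length xs = Suc k \<Longrightarrow> P (xs ! 0) (tl xs) \<longleftrightarrow> (\<exists>z. Q z xs)"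
    using assms by (rule Sigma0_SucE) (rule that)
  have "Pi0 n (Suc k) (\<lambda>ys. Q (pfst (ys ! 0)) (psnd (ys ! 0) # tl ys))"
    by (rule Pi0_subst[OF Q(1), where H = "\<lambda>ys. pfst (ys ! 0) # psnd (ys ! 0) # tl ys", simplified]; intro cfi; simp)
  then have "Sigma0 (Suc n) k (\<lambda>xs. \<exists>y. Q (pfst y) (psnd y # xs))"
    by (rule Sigma0_SucI)
  then show ?thesis
  proof (rule Sigma0_cong)
    fix xs :: "nat list" assume "length xs = k"
    then have "P y xs \<longleftrightarrow> (\<exists>z. Q z (y # xs))" for y
      using Q(2)[of "y # xs"] by simp
    then show "(\<exists>y. Q (pfst y) (psnd y # xs)) = (\<exists>y. P y xs)"
      by (metis pfst_encode psnd_encode)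
  qed
qed

lemma Pi0_All [sgi]:
  assumes "Pi0 (Suc n) (Suc k) (\<lambda>ys. P (ys ! 0) (tl ys))"
  shows "Pi0 (Suc n) k (\<lambda>xs. \<forall>y. P y xs)"
  using Sigma0_Ex[OF assms[unfolded Pi0_def]] unfolding Pi0_def by simp

lemma Sigma0_Ex_less [sgi]:
  assumes "computable k H" "Sigma0 n (Suc k) (\<lambda>ys. P (ys ! 0) (tl ys))"
  shows "Sigma0 n k (\<lambda>xs. \<exists>i<H xs. P i xs)"
proof (cases n)
  case 0
  then show ?thesis using assms computable.rel_Ex_less[of k H P] by simp
next
  case (Suc m)
  have "decidable (Suc k) (\<lambda>ys. ys ! 0 < H (tl ys))"
    using computable.cf_tl[OF assms(1)] by (auto intro!: cfi)
  then have "Sigma0 n (Suc k) (\<lambda>ys. ys ! 0 < H (tl ys) \<and> P (ys ! 0) (tl ys))"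
    by (intro Sigma0_and[OF Sigma0_decidable assms(2)])
  then show ?thesis
    unfolding Suc by (rule Sigma0_Ex)
qed

lemma Sigma0_All_less [sgi]:
  assumes "computable k H" "Sigma0 n (Suc k) (\<lambda>ys. P (ys ! 0) (tl ys))"
  shows "Sigma0 n k (\<lambda>xs. \<forall>i<H xs. P i xs)"
proof (cases n)
  case 0
  then show ?thesis using assms computable.rel_All_less[of k H P] by simp
next
  case (Suc m)
  obtain Q where Q: "Pi0 m (Suc (Suc k)) (\<lambda>ys. Q (ys ! 0) (tl ys))"
    "\<And>xs. length xs = Suc k \<Longrightarrow> P (xs ! 0) (tl xs) \<longleftrightarrow> (\<exists>z. Q z xs)"
    using assms(2) unfolding Suc by (rule Sigma0_SucE) (rule that)
  have "Pi0 m (Suc (Suc k)) (\<lambda>ys. Q (lnth (tl ys ! 0) (ys ! 0)) (ys ! 0 # tl (tl ys)))"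
    by (rule Pi0_subst[OF Q(1), where H = "\<lambda>ys. lnth (tl ys ! 0) (ys ! 0) # ys ! 0 # tl (tl ys)", simplified]; intro cfi; simp)
  then have "Sigma0 m (Suc k) (\<lambda>ys. \<exists>i<H (tl ys). \<not> Q (lnth (ys ! 0) i) (i # tl ys))"
    unfolding Pi0_def by (intro Sigma0_Ex_less computable.cf_tl assms(1))
  then have "Pi0 m (Suc k) (\<lambda>ys. \<forall>i<H (tl ys). Q (lnth (ys ! 0) i) (i # tl ys))"
    unfolding Pi0_def by simp
  then have "Sigma0 (Suc m) k (\<lambda>xs. \<exists>c. \<forall>i<H xs. Q (lnth c i) (i # xs))"
    by (rule Sigma0_SucI)
  then show ?thesis unfolding Suc
  proof (rule Sigma0_cong)
    fix xs :: "nat list" assume "length xs = k"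
    then have *: "P i xs \<longleftrightarrow> (\<exists>z. Q z (i # xs))" for i
      using Q(2)[of "i # xs"] by simp
    show "(\<exists>c. \<forall>i<H xs. Q (lnth c i) (i # xs)) = (\<forall>i<H xs. P i xs)"
    proof
      assume "\<forall>i<H xs. P i xs"
      then obtain f where f: "\<And>i. i < H xs \<Longrightarrow> Q (f i) (i # xs)"
        using * by metis
      obtain c where "\<forall>i<H xs. lnth c i = f i" using lnth_choice[of _ f] by blast
      with f have "\<forall>i<H xs. Q (lnth c i) (i # xs)" by simp
      then show "\<exists>c. \<forall>i<H xs. Q (lnth c i) (i # xs)" by blast
    qed (use * in auto)
  qed
qed

section \<open>Functions with a \<open>\<Sigma>\<^sup>0\<^sub>n\<close> graph\<close>

text \<open>The level is shifted by one, so that \<open>Sigma_fun n\<close> is the class of (total) \<open>\<Delta>\<^sup>0\<^sub>n\<^sub>+\<^sub>1\<close> functions.\<close>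

definition Sigma_fun :: "nat \<Rightarrow> nat \<Rightarrow> (nat list \<Rightarrow> nat) \<Rightarrow> bool" where
  "Sigma_fun n k F \<longleftrightarrow> Sigma0 (Suc n) (Suc k) (\<lambda>ys. F (tl ys) = ys ! 0)"

lemma Sigma_fun_computable: "computable k F \<Longrightarrow> Sigma_fun n k F"
  unfolding Sigma_fun_def
  by (intro Sigma0_decidable computable.rel_eq computable.cf_tl computable.cf_nth) simp_all

lemma Sigma_fun_tl:
  assumes F: "Sigma_fun n k F" shows "Sigma_fun n (Suc k) (\<lambda>xs. F (tl xs))"
  unfolding Sigma_fun_def
  by (rule Sigma0_subst[OF F[unfolded Sigma_fun_def], where H = "\<lambda>ys. ys ! 0 # tl (tl ys)",
      simplified]; intro cfi; simp)

text \<open>The values of the substituted functions are guessed as one code \<open>c\<close> and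
  verified through their graphs, which therefore occur only positively.\<close>

lemma Sigma0_subst_Sigma_fun:
  assumes R: "Sigma0 (Suc n) (length Gs) R" and Gs: "\<forall>G\<in>set Gs. Sigma_fun n k G"
  shows "Sigma0 (Suc n) k (\<lambda>xs. R (map (\<lambda>G. G xs) Gs))"
proof -
  define V where "V = (\<lambda>c. map (lnth c) [0..<length Gs])"
  \<comment> \<open>The index \<open>i\<close> selects a function and is not an argument of one
    fixed relation, so the conjunction is assembled by induction on \<open>j\<close> and not by
    \<open>Sigma0_All_less\<close>.\<close>
  have g: "Sigma0 (Suc n) (Suc k) (\<lambda>ys. (\<forall>i<j. (Gs ! i) (tl ys) = lnth (ys ! 0) i))" if "j \<le> length Gs" for j
    using that
  proof (induction j)
    case 0
    show ?case by (intro Sigma0_decidable) (auto intro: cfi)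
  next
    case (Suc j)
    then have *: "Sigma_fun n k (Gs ! j)" using Gs by auto
    have "Sigma0 (Suc n) (Suc k) (\<lambda>ys. (Gs ! j) (tl ys) = lnth (ys ! 0) j)"
      by (rule Sigma0_subst[OF *[unfolded Sigma_fun_def], where H = "\<lambda>ys. lnth (ys ! 0) j # tl ys",
          simplified]; intro cfi; simp)
    with Suc have "Sigma0 (Suc n) (Suc k) (\<lambda>ys. (\<forall>i<j. (Gs ! i) (tl ys) = lnth (ys ! 0) i)
      \<and> (Gs ! j) (tl ys) = lnth (ys ! 0) j)"
      by (intro Sigma0_and) simp_all
    then show ?case by (rule Sigma0_cong) (auto simp: less_Suc_eq)
  qed
  have r: "Sigma0 (Suc n) (Suc k) (\<lambda>ys. R (V (ys ! 0)))"
  proof (rule Sigma0_subst[OF R])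
    show "clist (Suc k) (length Gs) (\<lambda>ys. V (ys ! 0))"
      unfolding clist_def V_def
      by (auto simp del: upt_Suc intro!: computable.cf_lnth computable.cf_nth computable.cf_const)
  qed
  have "Sigma0 (Suc n) k (\<lambda>xs. \<exists>c. (\<forall>i<length Gs. (Gs ! i) xs = lnth c i) \<and> R (V c))"
    by (rule Sigma0_Ex, rule Sigma0_and) (rule g[OF order_refl], rule r)
  then show ?thesis
  proof (rule Sigma0_cong)
    fix xs :: "nat list"
    obtain c0 where c0: "\<forall>i<length Gs. lnth c0 i = (Gs ! i) xs"
      using lnth_choice[of _ "\<lambda>i. (Gs ! i) xs"] by blast
    have V: "V c = map (\<lambda>G. G xs) Gs" if "\<forall>i<length Gs. (Gs ! i) xs = lnth c i" for c
      by (rule nth_equalityI) (simp_all add: V_def that)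
    show "(\<exists>c. (\<forall>i<length Gs. (Gs ! i) xs = lnth c i) \<and> R (V c)) = R (map (\<lambda>G. G xs) Gs)"
    proof
      assume "R (map (\<lambda>G. G xs) Gs)"
      then show "\<exists>c. (\<forall>i<length Gs. (Gs ! i) xs = lnth c i) \<and> R (V c)"
        using c0 V[of c0] by (intro exI[of _ c0]) simp
    qed (use V in auto)
  qed
qed

lemma Sigma_fun_comp:
  assumes F: "Sigma_fun n (length Gs) F" and Gs: "\<forall>G\<in>set Gs. Sigma_fun n k G"
  shows "Sigma_fun n k (\<lambda>xs. F (map (\<lambda>G. G xs) Gs))"
proof -
  let ?Gs = "(\<lambda>ys. ys ! 0) # map (\<lambda>G ys. G (tl ys)) Gs"
  have "\<forall>G\<in>set ?Gs. Sigma_fun n (Suc k) G"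
    using Gs by (auto intro!: Sigma_fun_tl Sigma_fun_computable[OF computable.cf_nth])
  then show ?thesis
    using Sigma0_subst_Sigma_fun[of n ?Gs "\<lambda>ys. F (tl ys) = ys ! 0" "Suc k"] F
    unfolding Sigma_fun_def by (simp add: comp_def)
qed

text \<open>The code \<open>c\<close> lists the successive values of the recursion; checking each
  entry against the previous one determines the entry at the recursion argument.\<close>

lemma Sigma_fun_primrec:
  assumes F: "Sigma_fun n k F" and G: "Sigma_fun n (Suc (Suc k)) G"
  shows "Sigma_fun n (Suc k) (\<lambda>xs. rec_nat (F (tl xs)) (\<lambda>m y. G (m # y # tl xs)) (hd xs))"
proof -
  let ?rec = "\<lambda>xs. rec_nat (F (tl xs)) (\<lambda>m y. G (m # y # tl xs)) (hd xs)"
  have "Sigma0 (Suc n) (Suc (Suc (Suc k))) (\<lambda>zs. F (tl (tl (tl zs))) = lnth (zs ! 0) 0)"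
    by (rule Sigma0_subst[OF F[unfolded Sigma_fun_def], where H = "\<lambda>zs. lnth (zs ! 0) 0 # tl (tl (tl zs))",
          simplified]; intro cfi; simp)
  moreover have "Sigma0 (Suc n) (Suc (Suc (Suc (Suc k))))
      (\<lambda>zs. G (zs ! 0 # lnth (tl zs ! 0) (zs ! 0) # tl (tl (tl (tl zs)))) = lnth (tl zs ! 0) (Suc (zs ! 0)))"
    by (rule Sigma0_subst[OF G[unfolded Sigma_fun_def], where H = "\<lambda>zs. lnth (tl zs ! 0) (Suc (zs ! 0)) # zs ! 0 # lnth (tl zs ! 0) (zs ! 0) # tl (tl (tl (tl zs)))",
          simplified]; intro cfi; simp)
  ultimately have "Sigma0 (Suc n) (Suc (Suc k)) (\<lambda>ys. \<exists>c. F (tl (tl ys)) = lnth c 0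
      \<and> (\<forall>i<tl ys ! 0. G (i # lnth c i # tl (tl ys)) = lnth c (Suc i)) \<and> lnth c (tl ys ! 0) = ys ! 0)"
    by (intro sgi) (auto intro!: cfi Sigma0_decidable)
  then show ?thesis unfolding Sigma_fun_def
  proof (rule Sigma0_cong)
    fix ys :: "nat list" assume "length ys = Suc (Suc k)"
    then obtain z x rest where ys: "ys = z # x # rest" by (auto simp: length_Suc_conv)
    let ?r = "rec_nat (F rest) (\<lambda>m y. G (m # y # rest))"
    have "lnth c x = ?r x" if "F rest = lnth c 0" "\<forall>i<x. G (i # lnth c i # rest) = lnth c (Suc i)" for c
      using that by (induction x) (auto simp: less_Suc_eq)
    moreover obtain c where "\<forall>i<Suc x. lnth c i = ?r i"
      using lnth_choice[of _ ?r] by blast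
    ultimately show "(\<exists>c. F (tl (tl ys)) = lnth c 0
        \<and> (\<forall>i<tl ys ! 0. G (i # lnth c i # tl (tl ys)) = lnth c (Suc i)) \<and> lnth c (tl ys ! 0) = ys ! 0)
      \<longleftrightarrow> ?rec (tl ys) = ys ! 0"
      unfolding ys by (auto intro!: exI[of _ c])
  qed
qed

text \<open>Minimality is said positively: a nonzero value is expressed as \<open>Suc v\<close> for
  some \<open>v\<close>, so that the graph of \<open>F\<close> is never negated.\<close>

lemma Sigma_fun_Least_zero:
  assumes F: "Sigma_fun n (Suc k) F" and ex: "\<And>xs. length xs = k \<Longrightarrow> \<exists>m. F (m # xs) = 0"
  shows "Sigma_fun n k (\<lambda>xs. LEAST m. F (m # xs) = 0)"
proof -
  have "Sigma0 (Suc n) (Suc k) (\<lambda>ys. F (ys ! 0 # tl ys) = 0)"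
    by (rule Sigma0_subst[OF F[unfolded Sigma_fun_def], where H = "\<lambda>ys. 0 # ys ! 0 # tl ys",
          simplified]; intro cfi; simp)
  moreover have "Sigma0 (Suc n) (Suc (Suc (Suc k))) (\<lambda>zs. F (tl zs ! 0 # tl (tl (tl zs))) = Suc (zs ! 0))"
    by (rule Sigma0_subst[OF F[unfolded Sigma_fun_def], where H = "\<lambda>zs. Suc (zs ! 0) # tl zs ! 0 # tl (tl (tl zs))",
          simplified]; intro cfi; simp)
  ultimately have "Sigma0 (Suc n) (Suc k) (\<lambda>ys. F (ys ! 0 # tl ys) = 0
      \<and> (\<forall>i<ys ! 0. \<exists>v. F (i # tl ys) = Suc v))"
    by (intro sgi) (auto intro!: cfi)
  then show ?thesis unfolding Sigma_fun_def
  proof (rule Sigma0_cong)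
    fix ys :: "nat list" assume "length ys = Suc k"
    then obtain z xs where ys: "ys = z # xs" "length xs = k" by (auto simp: length_Suc_conv)
    have "(\<exists>v. F (i # xs) = Suc v) \<longleftrightarrow> F (i # xs) \<noteq> 0" for i by (cases "F (i # xs)") auto
    moreover have "F (z # xs) = 0 \<and> (\<forall>i<z. F (i # xs) \<noteq> 0) \<longleftrightarrow> (LEAST m. F (m # xs) = 0) = z"
    proof
      assume "F (z # xs) = 0 \<and> (\<forall>i<z. F (i # xs) \<noteq> 0)"
      then show "(LEAST m. F (m # xs) = 0) = z"
        by (intro Least_equality) (auto simp: not_less[symmetric])
    next
      assume "(LEAST m. F (m # xs) = 0) = z"
      then show "F (z # xs) = 0 \<and> (\<forall>i<z. F (i # xs) \<noteq> 0)"
        using LeastI_ex[OF ex[OF ys(2)]] not_less_Least[of _ "\<lambda>m. F (m # xs) = 0"] by metis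
    qed
    ultimately show "F (ys ! 0 # tl ys) = 0 \<and> (\<forall>i<ys ! 0. \<exists>v. F (i # tl ys) = Suc v)
      \<longleftrightarrow> (LEAST m. F (m # tl ys) = 0) = ys ! 0"
      by (simp add: ys(1))
  qed
qed

text \<open>A characteristic function with a \<open>\<Sigma>\<close> graph defines the relation by
  its value 1 and the complement by its value 0, so the relations of this class are exactly the
  \<open>\<Delta>\<close> ones.\<close>

global_interpretation Delta: function_class "Sigma_fun n"
  rewrites "function_class.rel (Sigma_fun n) = Delta0 (Suc n)"
  for n
proof -
  show fc: "function_class (Sigma_fun n)"
  proof
    show "Sigma_fun n k F \<Longrightarrow> (\<And>xs. length xs = k \<Longrightarrow> F xs = G xs) \<Longrightarrow> Sigma_fun n k G" for k F G
      unfolding Sigma_fun_def by (erule Sigma0_cong) simp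
    show "Sigma_fun n k (\<lambda>xs. 0)" for k
      by (intro Sigma_fun_computable cfi)
    show "i < k \<Longrightarrow> Sigma_fun n k (\<lambda>xs. xs ! i)" for i k
      by (intro Sigma_fun_computable cfi)
    show "Sigma_fun n k (\<lambda>xs. Suc (F xs))" if "Sigma_fun n k F" for k F
    proof -
      have "computable 1 (\<lambda>xs. Suc (xs ! 0))" by (intro cfi) simp
      with that show ?thesis
        using Sigma_fun_comp[of n "[F]" "\<lambda>xs. Suc (xs ! 0)" k] Sigma_fun_computable by simp
    qed
  qed (fact Sigma_fun_comp Sigma_fun_primrec Sigma_fun_Least_zero)+
  have "Sigma_fun n k (\<lambda>xs. if R xs then 1 else 0) \<longleftrightarrow> Delta0 (Suc n) k R" for k R
  proof
    assume *: "Sigma_fun n k (\<lambda>xs. if R xs then 1 else 0)"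
    have i: "Sigma0 (Suc n) k (\<lambda>xs. (if R xs then 1 else 0) = i)" for i :: nat
      by (rule Sigma0_subst[OF *[unfolded Sigma_fun_def], where H = "\<lambda>xs. i # xs", simplified])
        (intro cfi, auto simp: clist_def intro: cfi)
    show "Delta0 (Suc n) k R"
      unfolding Delta0_def Pi0_def
      using Sigma0_cong[OF i[of 1], of R] Sigma0_cong[OF i[of 0], of "\<lambda>xs. \<not> R xs"]
      by (auto split: if_splits)
  next
    assume "Delta0 (Suc n) k R"
    then have "Sigma0 (Suc n) (Suc k) (\<lambda>ys. R (tl ys))" "Sigma0 (Suc n) (Suc k) (\<lambda>ys. \<not> R (tl ys))"
      using Sigma0_subst[OF _ clist_tl(1)[OF refl], of "Suc n" k R]
        Sigma0_subst[OF _ clist_tl(1)[OF refl], of "Suc n" k "\<lambda>xs. \<not> R xs"]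
      unfolding Delta0_def Pi0_def by simp_all
    moreover have dec: "decidable (Suc k) (\<lambda>ys. ys ! 0 = i)" for i by (intro cfi) simp
    ultimately have "Sigma0 (Suc n) (Suc k) (\<lambda>ys. R (tl ys) \<and> ys ! 0 = 1 \<or> \<not> R (tl ys) \<and> ys ! 0 = 0)"
      by (intro Sigma0_or Sigma0_and Sigma0_decidable[OF dec])
    then show "Sigma_fun n k (\<lambda>xs. if R xs then 1 else 0)"
      unfolding Sigma_fun_def by (rule Sigma0_cong) auto
  qed
  then show "function_class.rel (Sigma_fun n) = Delta0 (Suc n)"
    by (intro ext) (simp add: function_class.rel_def[OF fc])
qed

lemma Sigma0_subst2:
  assumes "Sigma0 n 2 (\<lambda>xs. P (xs ! 0) (xs ! 1))" "computable k F" "computable k G"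
  shows "Sigma0 n k (\<lambda>xs. P (F xs) (G xs))"
proof -
  have "clist k 2 (\<lambda>xs. [F xs, G xs])"
    unfolding numeral_2_eq_2 by (intro clist_Cons clist_Nil assms)
  from Sigma0_subst[OF assms(1) this] show ?thesis by simp
qed

lemma Sigma0_subst3:
  assumes "Sigma0 n 3 (\<lambda>xs. P (xs ! 0) (xs ! 1) (xs ! 2))"
    "computable k F" "computable k G" "computable k H"
  shows "Sigma0 n k (\<lambda>xs. P (F xs) (G xs) (H xs))"
proof -
  have "clist k 3 (\<lambda>xs. [F xs, G xs, H xs])"
    unfolding numeral_3_eq_3 by (intro clist_Cons clist_Nil assms)
  from Sigma0_subst[OF assms(1) this] show ?thesis by simp
qed

lemma Delta0_SucI: "Sigma0 n k R \<or> Pi0 n k R \<Longrightarrow> Delta0 (Suc n) k R"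
  unfolding Delta0_def Pi0_def
  using Sigma0_Pi0_mono[of n k R] Sigma0_mono[of n k R] Sigma0_mono[of n k "\<lambda>xs. \<not> R xs"]
    Sigma0_Pi0_mono[of n k "\<lambda>xs. \<not> R xs"] by (auto simp: Pi0_def)

lemma Delta0_fun_Sigma_fun:
  assumes "Sigma_fun n 1 (\<lambda>xs. p (xs ! 0))" shows "Delta0_fun (Suc n) p"
proof -
  have "Delta0 (Suc n) 2 (\<lambda>xs. p (xs ! 0) = xs ! 1)"
    by (intro cfi Delta.cf_subst1[OF assms]) simp_all
  then show ?thesis by (simp add: Delta0_fun_def)
qed

section \<open>Forcing with finite binary strings\<close>

text \<open>The forcing conditions are the codes of finite binary strings.\<close>

definition binary :: "nat \<Rightarrow> bool" where
  "binary s \<longleftrightarrow> (\<forall>i<llen s. lnth s i < 2)"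

definition ext :: "nat \<Rightarrow> nat \<Rightarrow> bool" where
  "ext s t \<longleftrightarrow> lprefix s t \<and> binary t"

definition seg :: "(nat \<Rightarrow> nat) \<Rightarrow> nat \<Rightarrow> nat" where
  "seg x a = list_encode (map x [0..<a])"

lemma lprefix_trans: "lprefix r s \<Longrightarrow> lprefix s t \<Longrightarrow> lprefix r t"
  unfolding lprefix_def by (rule prefix_order.trans)

lemma lprefix_refl [simp]: "lprefix s s"
  by (simp add: lprefix_def)

lemma ext_trans: "ext r s \<Longrightarrow> ext s t \<Longrightarrow> ext r t"
  unfolding ext_def using lprefix_trans by blast

lemma ext_refl: "binary s \<Longrightarrow> ext s s"
  by (simp add: ext_def)

lemma llen_seg [simp]: "llen (seg x a) = a"
  by (simp add: seg_def)

lemma lnth_seg [simp]: "i < a \<Longrightarrow> lnth (seg x a) i = x i"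
  by (simp add: seg_def)

lemma lprefix_seg: "lprefix s (seg x a) \<longleftrightarrow> llen s \<le> a \<and> (\<forall>i<llen s. lnth s i = x i)"
  by (auto simp: lprefix_iff)

lemma binary_seg: "(\<And>i. x i < 2) \<Longrightarrow> binary (seg x a)"
  by (simp add: binary_def)

lemma ext_seg: "(\<And>i. x i < 2) \<Longrightarrow> a \<le> b \<Longrightarrow> ext (seg x a) (seg x b)"
  by (simp add: ext_def binary_seg lprefix_seg)

definition incompatible :: "nat \<Rightarrow> nat \<Rightarrow> bool" where
  "incompatible s t \<longleftrightarrow> (\<exists>i<llen s. i < llen t \<and> lnth s i \<noteq> lnth t i)"

lemma incompatible_mono: "incompatible r s \<Longrightarrow> lprefix s t \<Longrightarrow> incompatible r t"
  unfolding incompatible_def lprefix_iff by (metis order_less_le_trans)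

text \<open>This is the function whose computability \<open>computable_ltree\<close> demands: 0 for
  no node, 1 for a union, 2 for an intersection, and from 3 on the codes of clopen labels.\<close>

definition lab :: "ltree \<Rightarrow> nat \<Rightarrow> nat" where
  "lab T c = (case T (list_decode c) of None \<Rightarrow> 0 | Some l \<Rightarrow> Suc (label_encode l))"

definition child :: "nat \<Rightarrow> nat \<Rightarrow> bool" where
  "child c d \<longleftrightarrow> llen d = Suc (llen c) \<and> lprefix c d"

lemma child_iff: "child c d \<longleftrightarrow> (\<exists>j. list_decode d = list_decode c @ [j])"
proof
  assume "child c d"
  then obtain zs where "list_decode d = list_decode c @ zs" "length zs = 1"
    by (auto simp: child_def llen_def lprefix_def prefix_def)
  then show "\<exists>j. list_decode d = list_decode c @ [j]" by (auto simp: length_Suc_conv)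
qed (auto simp: child_def llen_def lprefix_def)

text \<open>The sign \<open>b\<close> is 0 when membership in the coded set is forced and 1 when membership in its complement is.
  The decoded components of \<open>lab T c - 3\<close> are the number of the constructor of a clopen label and its argument.\<close>

definition forces_leaf :: "ltree \<Rightarrow> nat \<Rightarrow> nat \<Rightarrow> nat \<Rightarrow> bool" where
  "forces_leaf T b c s \<longleftrightarrow> 3 \<le> lab T c \<and>
    (pfst (lab T c - 3) = 0 \<and> b = 1 \<or> pfst (lab T c - 3) = 1 \<and> b = 0
      \<or> (pfst (lab T c - 3) = 2 \<and> b = 0 \<or> pfst (lab T c - 3) = 3 \<and> b = 1)
          \<and> lprefix (psnd (lab T c - 3)) s
      \<or> (pfst (lab T c - 3) = 2 \<and> b = 1 \<or> pfst (lab T c - 3) = 3 \<and> b = 0)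
          \<and> incompatible (psnd (lab T c - 3)) s)"

text \<open>\<open>forces T m\<close> is a \<open>\<Sigma>\<^sup>0\<^sub>m\<^sub>+\<^sub>1\<close> relation. It is meaningful at unions for \<open>b = 0\<close> and at intersections
  for \<open>b = 1\<close>. A child of the other kind is treated by negating the weaker relation for the other
  sign; the label of such a child is \<open>2 - b\<close> in the numbering of \<open>lab\<close>.\<close>

primrec forces :: "ltree \<Rightarrow> nat \<Rightarrow> nat \<Rightarrow> nat \<Rightarrow> nat \<Rightarrow> bool" where
  "forces T 0 b c s \<longleftrightarrow> forces_leaf T b c s \<or> (\<exists>d. child c d \<and> forces_leaf T b d s)"
| "forces T (Suc m) b c s \<longleftrightarrow> forces_leaf T b c s \<or>
    (\<exists>d. child c d \<and> lab T d \<noteq> 0 \<and>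
      (lab T d \<noteq> 2 - b \<and> forces T m b d s
       \<or> lab T d = 2 - b \<and> (\<forall>t. ext s t \<longrightarrow> \<not> forces T m (1 - b) d t)))"

text \<open>The index \<open>e\<close> is a pair: first entry 0 passes the second entry to the level
  below, any other first entry makes the second a pair of a sign and an address. Level
  \<open>Suc m\<close> settles \<open>forces T m\<close>, the relation negated inside
  \<open>forces T (Suc m)\<close>; level 0 demands nothing, as \<open>forces T 0\<close> contains no
  negation.\<close>

primrec decides :: "ltree \<Rightarrow> nat \<Rightarrow> nat \<Rightarrow> nat \<Rightarrow> bool" where
  "decides T 0 e s \<longleftrightarrow> True"
| "decides T (Suc m) e s \<longleftrightarrow>
    (if pfst e = 0 then decides T m (psnd e) s
     else forces T m (pfst (psnd e)) (psnd (psnd e)) s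
       \<or> (\<forall>t. ext s t \<longrightarrow> \<not> forces T m (pfst (psnd e)) (psnd (psnd e)) t))"

section \<open>Monotonicity and density\<close>

lemma forces_leaf_lab: "forces_leaf T b c s \<Longrightarrow> lab T c \<noteq> 0"
  by (auto simp: forces_leaf_def)

lemma forces_leaf_mono: "forces_leaf T b c s \<Longrightarrow> lprefix s t \<Longrightarrow> forces_leaf T b c t"
  unfolding forces_leaf_def using incompatible_mono lprefix_trans by blast

lemma forces_mono: "forces T m b c s \<Longrightarrow> ext s t \<Longrightarrow> forces T m b c t"
proof (induction m arbitrary: b c)
  case 0
  then show ?case using forces_leaf_mono by (auto simp: ext_def)
next
  case (Suc m)
  show ?case
  proof (cases "forces_leaf T b c s")
    case True
    then show ?thesis using Suc.prems(2) forces_leaf_mono by (auto simp: ext_def)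
  next
    case False
    then obtain d where "child c d" "lab T d \<noteq> 0"
      "lab T d \<noteq> 2 - b \<and> forces T m b d s
       \<or> lab T d = 2 - b \<and> (\<forall>t. ext s t \<longrightarrow> \<not> forces T m (1 - b) d t)"
      using Suc.prems(1) by auto
    moreover from this(3) have "lab T d \<noteq> 2 - b \<and> forces T m b d t
       \<or> lab T d = 2 - b \<and> (\<forall>u. ext t u \<longrightarrow> \<not> forces T m (1 - b) d u)"
      using Suc.IH Suc.prems(2) ext_trans by blast
    ultimately show ?thesis by auto
  qed
qed

lemma decides_mono: "decides T m e s \<Longrightarrow> ext s t \<Longrightarrow> decides T m e t"
proof (induction m arbitrary: e)
  case (Suc m)
  show ?case
  proof (cases "pfst e = 0")
    case True
    with Suc show ?thesis by simp
  next
    case False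
    let ?P = "forces T m (pfst (psnd e)) (psnd (psnd e))"
    have "?P s \<or> (\<forall>u. ext s u \<longrightarrow> \<not> ?P u)" using Suc.prems(1) False by simp
    then have "?P t \<or> (\<forall>u. ext t u \<longrightarrow> \<not> ?P u)"
      using Suc.prems(2) forces_mono ext_trans by blast
    with False show ?thesis by simp
  qed
qed simp

lemma decides_dense: "binary s \<Longrightarrow> \<exists>t. ext s t \<and> decides T m e t"
proof (induction m arbitrary: e)
  case 0
  then show ?case using ext_refl by auto
next
  case (Suc m)
  show ?case
  proof (cases "pfst e = 0")
    case False
    then show ?thesis using ext_refl[OF Suc.prems] by auto
  qed (use Suc in auto)
qed

section \<open>Definability of forcing\<close>

context function_class
begin

lemma rel_binary [cfi]: assumes "cf k F" shows "rel k (\<lambda>xs. binary (F xs))"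
proof -
  have "rel 1 (\<lambda>xs. binary (xs ! 0))" unfolding binary_def by (intro cfi) simp_all
  then show ?thesis using rel_subst1[of binary, OF _ assms] by simp
qed

lemma rel_ext [cfi]: "cf k F \<Longrightarrow> cf k G \<Longrightarrow> rel k (\<lambda>xs. ext (F xs) (G xs))"
  unfolding ext_def by (intro cfi)

lemma rel_child [cfi]: "cf k F \<Longrightarrow> cf k G \<Longrightarrow> rel k (\<lambda>xs. child (F xs) (G xs))"
  unfolding child_def by (intro cfi)

lemma rel_incompatible [cfi]:
  assumes "cf k F" "cf k G" shows "rel k (\<lambda>xs. incompatible (F xs) (G xs))"
proof -
  have "rel 2 (\<lambda>xs. incompatible (xs ! 0) (xs ! 1))" unfolding incompatible_def by (intro cfi) simp_all
  then show ?thesis using rel_subst2[of incompatible, OF _ assms] by simp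
qed

end

context
  fixes T :: ltree
  assumes T: "computable_ltree T"
begin

lemma computable_lab: "computable k F \<Longrightarrow> computable k (\<lambda>xs. lab T (F xs))"
  by (rule computable.cf_subst1[of "lab T"]) (use T in \<open>simp_all add: computable_ltree_def lab_def\<close>)

lemma decidable_forces_leaf:
  "computable k B \<Longrightarrow> computable k F \<Longrightarrow> computable k G
    \<Longrightarrow> decidable k (\<lambda>xs. forces_leaf T (B xs) (F xs) (G xs))"
  unfolding forces_leaf_def by (intro cfi computable_lab)

text \<open>Each level costs one quantifier: excluding \<open>forces T m\<close> on all extensions
  is \<open>\<Pi>\<^sup>0\<^sub>m\<^sub>+\<^sub>1\<close>, hence \<open>\<Sigma>\<close> one level
  up, where the choice of a child is absorbed.\<close>

lemma Sigma0_forces: "Sigma0 (Suc m) 3 (\<lambda>xs. forces T m (xs ! 0) (xs ! 1) (xs ! 2))"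
proof (induction m)
  case 0
  have "decidable 3 (\<lambda>xs. forces_leaf T (xs ! 0) (xs ! 1) (xs ! 2))"
    by (intro decidable_forces_leaf cfi) simp_all
  moreover have "decidable (Suc 3)
      (\<lambda>ys. child (tl ys ! 1) (ys ! 0) \<and> forces_leaf T (tl ys ! 0) (ys ! 0) (tl ys ! 2))"
    by (intro decidable_forces_leaf cfi) simp_all
  ultimately show ?case
    unfolding forces.simps
    by (intro Sigma0_or Sigma0_Ex Sigma0_decidable[of 3] Sigma0_decidable[of "Suc 3"])
next
  case (Suc m)
  have d0: "decidable 3 (\<lambda>xs. forces_leaf T (xs ! 0) (xs ! 1) (xs ! 2))"
    by (intro decidable_forces_leaf cfi) simp_all
  have d: "decidable (Suc 3) (\<lambda>ys. child (tl ys ! 1) (ys ! 0))"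
    "decidable (Suc 3) (\<lambda>ys. lab T (ys ! 0) \<noteq> 0)"
    "decidable (Suc 3) (\<lambda>ys. lab T (ys ! 0) \<noteq> 2 - tl ys ! 0)"
    "decidable (Suc 3) (\<lambda>ys. lab T (ys ! 0) = 2 - tl ys ! 0)"
    by (intro cfi computable_lab; simp)+
  have f: "Sigma0 (Suc (Suc m)) (Suc 3) (\<lambda>ys. forces T m (tl ys ! 0) (ys ! 0) (tl ys ! 2))"
    by (intro Sigma0_mono Sigma0_subst3[OF Suc.IH] cfi) simp_all
  have g: "Sigma0 (Suc (Suc m)) (Suc 3)
      (\<lambda>ys. \<forall>t. ext (tl ys ! 2) t \<longrightarrow> \<not> forces T m (1 - tl ys ! 0) (ys ! 0) t)"
  proof -
    have d: "decidable (Suc (Suc 3)) (\<lambda>zs. \<not> ext (tl (tl zs) ! 2) (zs ! 0))"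
      by (intro cfi) simp_all
    have f: "Sigma0 (Suc m) (Suc (Suc 3)) (\<lambda>zs. forces T m (1 - tl (tl zs) ! 0) (tl zs ! 0) (zs ! 0))"
      by (intro Sigma0_subst3[OF Suc.IH] cfi) simp_all
    show ?thesis
      unfolding imp_conv_disj
      by (intro Sigma0_Pi0_mono Pi0_All Pi0_or Pi0_decidable[OF d] Pi0_not[OF f])
  qed
  show ?case
    unfolding forces.simps
    by (intro Sigma0_or Sigma0_and Sigma0_Ex Sigma0_decidable[OF d0] d[THEN Sigma0_decidable] f g)
qed

text \<open>Only forcing statements below level \<open>m\<close> are mentioned, as a disjunction of
  a \<open>\<Sigma>\<close> and a \<open>\<Pi>\<close> relation. So this is \<open>\<Delta>\<close>
  at the level where \<open>forces T m\<close> itself was shown to be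
  \<open>\<Sigma>\<close>.\<close>

lemma Delta0_decides: "Delta0 (Suc m) 2 (\<lambda>xs. decides T m (xs ! 0) (xs ! 1))"
proof (induction m)
  case 0
  show ?case by (auto intro: cfi)
next
  case (Suc m)
  have "Sigma0 (Suc m) 2 (\<lambda>xs. decides T m (xs ! 0) (xs ! 1))"
    using Suc.IH by (simp add: Delta0_def)
  then have "Sigma0 (Suc m) 2 (\<lambda>xs. decides T m (psnd (xs ! 0)) (xs ! 1))"
    by (rule Sigma0_subst2) (intro cfi; simp)+
  then have 1: "Sigma_fun (Suc m) 2 (\<lambda>xs. if decides T m (psnd (xs ! 0)) (xs ! 1) then 1 else 0)"
    by (intro cfi Delta0_SucI disjI1)
  have f: "Sigma0 (Suc m) 2 (\<lambda>xs. forces T m (pfst (psnd (xs ! 0))) (psnd (psnd (xs ! 0))) (xs ! 1))"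
    by (intro Sigma0_subst3[OF Sigma0_forces] cfi) simp_all
  have "Pi0 (Suc m) 2 (\<lambda>xs. \<forall>t. ext (xs ! 1) t \<longrightarrow> \<not> forces T m (pfst (psnd (xs ! 0))) (psnd (psnd (xs ! 0))) t)"
  proof -
    have d: "decidable (Suc 2) (\<lambda>zs. \<not> ext (tl zs ! 1) (zs ! 0))"
      by (intro cfi) simp_all
    have f: "Sigma0 (Suc m) (Suc 2) (\<lambda>zs. forces T m (pfst (psnd (tl zs ! 0))) (psnd (psnd (tl zs ! 0))) (zs ! 0))"
      by (intro Sigma0_subst3[OF Sigma0_forces] cfi) simp_all
    show ?thesis
      unfolding imp_conv_disj by (intro Pi0_All Pi0_or Pi0_decidable[OF d] Pi0_not[OF f])
  qed
  then have "Delta0 (Suc (Suc m)) 2 (\<lambda>xs. forces T m (pfst (psnd (xs ! 0))) (psnd (psnd (xs ! 0))) (xs ! 1)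
       \<or> (\<forall>t. ext (xs ! 1) t \<longrightarrow> \<not> forces T m (pfst (psnd (xs ! 0))) (psnd (psnd (xs ! 0))) t))"
    using f by (intro Delta.rel_or Delta0_SucI) simp_all
  then have 2: "Sigma_fun (Suc m) 2 (\<lambda>xs. if forces T m (pfst (psnd (xs ! 0))) (psnd (psnd (xs ! 0))) (xs ! 1)
       \<or> (\<forall>t. ext (xs ! 1) t \<longrightarrow> \<not> forces T m (pfst (psnd (xs ! 0))) (psnd (psnd (xs ! 0))) t) then 1 else 0)"
    by (simp add: Delta.rel_def)
  have "Delta0 (Suc (Suc m)) 2 (\<lambda>xs. pfst (xs ! 0) = 0)" by (intro cfi) simp
  from Delta.cf_if[OF this 1 2] have "Sigma_fun (Suc m) 2 (\<lambda>xs. if decides T (Suc m) (xs ! 0) (xs ! 1) then 1 else 0)"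
    by (rule Delta.cf_cong) simp
  then show ?case by (simp add: Delta.rel_def)
qed

end

section \<open>Forcing and truth\<close>

text \<open>The order condition reduces to \<open>x 0 = 0\<close>, so \<open>omega_two\<close> is an
  open part of Cantor space. Forcing may thus use all binary strings; starting with 0 and containing
  a 1 keeps the generic inside.\<close>

lemma omega_two_iff: "x \<in> omega_two \<longleftrightarrow> (\<forall>i. x i < 2) \<and> x 0 = 0 \<and> (\<exists>i. x i = 1)"
proof
  assume "x \<in> omega_two"
  then have r: "range x = {..<2}" and o: "(LEAST a. x a = 0) < (LEAST a. x a = 1)"
    by (auto simp: omega_parts_def ordered_surj_def)
  from r have lt: "x i < 2" for i by (metis lessThan_iff rangeI)
  have "x 0 \<noteq> 1"
  proof
    assume "x 0 = 1"
    then have "(LEAST a. x a = 1) = 0" by (intro Least_equality) auto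
    with o show False by simp
  qed
  moreover have "\<exists>i. x i = 1" using r by (metis imageE lessThan_iff one_less_numeral_iff semiring_norm(76))
  ultimately show "(\<forall>i. x i < 2) \<and> x 0 = 0 \<and> (\<exists>i. x i = 1)"
    using lt[of 0] lt by (simp add: less_2_cases_iff)
next
  assume x: "(\<forall>i. x i < 2) \<and> x 0 = 0 \<and> (\<exists>i. x i = 1)"
  then obtain k where k: "x k = 1" by auto
  have "(LEAST a. x a = 0) = 0" using x by (intro Least_equality) auto
  moreover have "x (LEAST a. x a = 1) = 1" using k by (rule LeastI)
  then have "(LEAST a. x a = 1) > 0" using x by (metis gr0I zero_neq_one)
  moreover have "range x = {..<2}"
  proof
    show "{..<2} \<subseteq> range x" using x k by (metis insert_subset empty_subsetI lessThan_Suc lessThan_0 numeral_2_eq_2 One_nat_def rangeI)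
  qed (use x in auto)
  ultimately show "x \<in> omega_two"
    by (auto simp: omega_parts_def ordered_surj_def less_2_cases_iff)
qed

section \<open>Signs of codes and the truth lemma\<close>

definition code :: "nat \<Rightarrow> nat \<Rightarrow> ltree \<Rightarrow> (nat \<Rightarrow> nat) set \<Rightarrow> bool" where
  "code b m S A \<longleftrightarrow> (if b = 0 then Sigma_code m S A else Pi_code m S A)"

definition signed_mem :: "nat \<Rightarrow> (nat \<Rightarrow> nat) \<Rightarrow> (nat \<Rightarrow> nat) set \<Rightarrow> bool" where
  "signed_mem b x A \<longleftrightarrow> (x \<in> A \<longleftrightarrow> b = 0)"

definition subtree :: "ltree \<Rightarrow> nat list \<Rightarrow> ltree" where
  "subtree T \<nu> = (\<lambda>\<mu>. T (\<nu> @ \<mu>))"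

lemma attached_subtree: "attached (subtree T \<nu>) j = subtree T (\<nu> @ [j])"
  by (simp add: attached_def subtree_def)

text \<open>Avoiding an intersection means avoiding one of its members, just as lying in a union
  means lying in one. With the sign matched to the root, both kinds of node are existential over the
  children.\<close>

lemma code_cases:
  assumes "code b m S A" "b \<le> 1"
  obtains (leaf) cl where "S [] = Some (Leaf cl)" "dom S = {[]}" "A = clopen_set cl"
  | (node) A' where "m \<ge> 1" "S [] = Some (if b = 0 then Cup else Cap)"
    "\<And>j. j \<in> level1 S \<Longrightarrow> \<exists>\<beta><m. \<exists>b'\<le>1. code b' \<beta> (attached S j) (A' j)"
    "\<And>x. x \<in> omega_two \<Longrightarrow> signed_mem b x A \<longleftrightarrow> (\<exists>j\<in>level1 S. signed_mem b x (A' j))"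
proof (cases "b = 0")
  case True
  with assms have "Sigma_code m S A" by (simp add: code_def)
  then show ?thesis
  proof cases
    case (Sigma_node A')
    show ?thesis
    proof (rule node[of A'])
      fix j assume "j \<in> level1 S"
      then obtain \<beta> where "\<beta> < m" "code 0 \<beta> (attached S j) (A' j) \<or> code 1 \<beta> (attached S j) (A' j)"
        using Sigma_node by (auto simp: code_def)
      then show "\<exists>\<beta><m. \<exists>b'\<le>1. code b' \<beta> (attached S j) (A' j)" by auto
    qed (use Sigma_node True in \<open>auto simp: signed_mem_def\<close>)
  qed (use leaf in auto)
next
  case False
  with assms have "Pi_code m S A" and b: "b = 1" by (simp_all add: code_def)
  then show ?thesis
  proof cases
    case (Pi_node A')
    show ?thesis
    proof (rule node[of A'])
      fix j assume "j \<in> level1 S"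
      then obtain \<beta> where "\<beta> < m" "code 0 \<beta> (attached S j) (A' j) \<or> code 1 \<beta> (attached S j) (A' j)"
        using Pi_node by (auto simp: code_def)
      then show "\<exists>\<beta><m. \<exists>b'\<le>1. code b' \<beta> (attached S j) (A' j)" by auto
    qed (use Pi_node b in \<open>auto simp: signed_mem_def\<close>)
  qed (use leaf in auto)
qed

lemma forces_leaf_truth:
  assumes x: "x \<in> omega_two" and T: "T (list_decode c) = Some (Leaf cl)" and b: "b \<le> 1"
  shows "signed_mem b x (clopen_set cl) \<longleftrightarrow> (\<exists>a. forces_leaf T b c (seg x a))"
proof -
  have lab: "lab T c = 3 + clopen_label_encode cl"
    using T by (simp add: lab_def)
  have pre: "x \<in> cylinder \<sigma> \<longleftrightarrow> (\<exists>a. lprefix (list_encode \<sigma>) (seg x a))" for \<sigma>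
    using x by (auto simp: cylinder_def lprefix_seg)
  have inc: "x \<notin> cylinder \<sigma> \<longleftrightarrow> (\<exists>a. incompatible (list_encode \<sigma>) (seg x a))" for \<sigma>
  proof
    assume "x \<notin> cylinder \<sigma>"
    then obtain i where i: "i < length \<sigma>" "x i \<noteq> \<sigma> ! i"
      using x by (auto simp: cylinder_def)
    then have "incompatible (list_encode \<sigma>) (seg x (Suc i))"
      unfolding incompatible_def by (intro exI[of _ i]) simp
    then show "\<exists>a. incompatible (list_encode \<sigma>) (seg x a)" ..
  qed (auto simp: cylinder_def incompatible_def)
  have "b = 0 \<or> b = 1" using b by auto
  then show ?thesis
    using x by (cases cl; elim disjE) (simp_all add: signed_mem_def forces_leaf_def lab flip: pre inc)
qed

lemma forces_at_leaf:
  assumes "subtree T (list_decode c) [] = Some (Leaf cl)" "dom (subtree T (list_decode c)) = {[]}"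
  shows "forces T m b c s \<longleftrightarrow> forces_leaf T b c s"
proof -
  have "lab T d = 0" if "child c d" for d
  proof -
    from that obtain j where "list_decode d = list_decode c @ [j]" by (auto simp: child_iff)
    moreover have "[j] \<notin> dom (subtree T (list_decode c))" using assms(2) by simp
    ultimately show ?thesis by (simp add: subtree_def lab_def domIff)
  qed
  then show ?thesis by (cases m) (auto simp: forces_leaf_def)
qed

lemma child_level1:
  "(\<exists>d. child c d \<and> lab T d \<noteq> 0 \<and> P d)
    \<longleftrightarrow> (\<exists>j\<in>level1 (subtree T (list_decode c)). P (list_encode (list_decode c @ [j])))"
proof -
  have "lab T d \<noteq> 0 \<longleftrightarrow> T (list_decode d) \<noteq> None" for d
    by (auto simp: lab_def split: option.splits)
  moreover have "j \<in> level1 (subtree T (list_decode c)) \<longleftrightarrow> T (list_decode c @ [j]) \<noteq> None" for j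
    by (simp add: level1_def subtree_def domIff)
  moreover have "child c d \<longleftrightarrow> (\<exists>j. d = list_encode (list_decode c @ [j]))" for d
    unfolding child_iff by (metis list_decode_inverse list_encode_inverse)
  ultimately show ?thesis
    unfolding Bex_def by (metis (no_types, lifting) list_encode_inverse)
qed

lemma forces_at_node:
  assumes "subtree T (list_decode c) [] = Some (if b = 0 then Cup else Cap)"
  shows "lab T c = (if b = 0 then 1 else 2)" "\<not> forces_leaf T b' c s"
proof -
  show "lab T c = (if b = 0 then 1 else 2)" using assms by (simp add: lab_def subtree_def)
  then show "\<not> forces_leaf T b' c s" by (auto simp: forces_leaf_def)
qed

text \<open>A partition is sufficiently generic for codes of rank \<open>m + 1\<close> when it meets all sets \<open>decides T m e\<close>.\<close>

lemma forces_truth: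
  assumes x: "x \<in> omega_two" and "\<And>e. \<exists>a. decides T m e (seg x a)"
    and "b \<le> 1" "code b \<beta> (subtree T (list_decode c)) A" "\<beta> \<le> Suc m"
  shows "signed_mem b x A \<longleftrightarrow> (\<exists>a. forces T m b c (seg x a))"
  using assms(2-)
proof (induction m arbitrary: b \<beta> c A)
  case (0 b \<beta> c A)
  let ?d = "\<lambda>j. list_encode (list_decode c @ [j])"
  from 0(3,2) show ?case
  proof (cases rule: code_cases)
    case (leaf cl)
    then show ?thesis
      unfolding leaf(3) forces_at_leaf[OF leaf(1,2)]
      by (intro forces_leaf_truth[OF x _ 0(2)]) (simp add: subtree_def)
  next
    case (node A')
    have "signed_mem b x (A' j) \<longleftrightarrow> (\<exists>a. forces_leaf T b (?d j) (seg x a))"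
      if j: "j \<in> level1 (subtree T (list_decode c))" for j
    proof -
      obtain \<beta>' b' where "\<beta>' < \<beta>" and b': "b' \<le> 1" "code b' \<beta>' (subtree T (list_decode c @ [j])) (A' j)"
        using node(3)[OF j] by (auto simp: attached_subtree)
      from b'(2,1) obtain cl where "subtree T (list_decode c @ [j]) [] = Some (Leaf cl)" "A' j = clopen_set cl"
        using \<open>\<beta>' < \<beta>\<close> 0(4) by (cases rule: code_cases) auto
      then show ?thesis using forces_leaf_truth[OF x, of T "?d j" cl b] 0(2) by (simp add: subtree_def)
    qed
    then have "signed_mem b x A \<longleftrightarrow>
        (\<exists>a. \<exists>j\<in>level1 (subtree T (list_decode c)). forces_leaf T b (?d j) (seg x a))"
      using node(4)[OF x] by auto
    also have "\<dots> \<longleftrightarrow> (\<exists>a. \<exists>d. child c d \<and> lab T d \<noteq> 0 \<and> forces_leaf T b d (seg x a))"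
      unfolding child_level1 ..
    also have "\<dots> \<longleftrightarrow> (\<exists>a. forces T 0 b c (seg x a))"
      unfolding forces.simps using forces_at_node(2)[OF node(2)] forces_leaf_lab by blast
    finally show ?thesis .
  qed
next
  case (Suc m b \<beta> c A)
  let ?d = "\<lambda>j. list_encode (list_decode c @ [j])"
  have lt2: "x i < 2" for i using x by (simp add: omega_two_iff)
  have gen: "\<exists>a. decides T m e (seg x a)" for e
    using Suc.prems(1)[of "prod_encode (0, e)"] by simp
  from Suc.prems(3,2) show ?case
  proof (cases rule: code_cases)
    case (leaf cl)
    then show ?thesis
      unfolding leaf(3) forces_at_leaf[OF leaf(1,2)]
      by (intro forces_leaf_truth[OF x _ Suc.prems(2)]) (simp add: subtree_def)
  next
    case (node A')
    let ?F = "\<lambda>d s. lab T d \<noteq> 2 - b \<and> forces T m b d s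
       \<or> lab T d = 2 - b \<and> (\<forall>t. ext s t \<longrightarrow> \<not> forces T m (1 - b) d t)"
    have "signed_mem b x (A' j) \<longleftrightarrow> (\<exists>a. ?F (?d j) (seg x a))"
      if j: "j \<in> level1 (subtree T (list_decode c))" for j
    proof -
      obtain \<beta>' b' where "\<beta>' < \<beta>" and b': "b' \<le> 1"
        and "code b' \<beta>' (subtree T (list_decode c @ [j])) (A' j)"
        using node(3)[OF j] unfolding attached_subtree by blast
      then have \<beta>': "\<beta>' \<le> Suc m" and code: "code b' \<beta>' (subtree T (list_decode (?d j))) (A' j)"
        using Suc.prems(4) by simp_all
      from code b' show ?thesis
      proof (cases rule: code_cases)
        case (leaf cl)
        then have "lab T (?d j) \<noteq> 2 - b" by (simp add: lab_def subtree_def)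
        then show ?thesis
          using leaf forces_at_leaf[OF leaf(1,2)] forces_leaf_truth[OF x, of T "?d j" cl b] Suc.prems(2)
          by (simp add: subtree_def)
      next
        case (node A'')
        note IH = Suc.IH[OF gen b' code \<beta>']
        show ?thesis
        proof (cases "b' = b")
          case True
          then have "lab T (?d j) \<noteq> 2 - b"
            using forces_at_node(1)[OF node(2)] b' by auto
          with IH True show ?thesis by simp
        next
          case False
          then have b'': "b' = 1 - b" and "lab T (?d j) = 2 - b"
            using forces_at_node(1)[OF node(2)] b' Suc.prems(2) by auto
          moreover have "signed_mem b x (A' j) \<longleftrightarrow> \<not> signed_mem b' x (A' j)"
            using False b' Suc.prems(2) by (auto simp: signed_mem_def)
          \<comment> \<open>Genericity for the index naming this statement turns the absence of a
            forcing segment into a segment that excludes forcing. Conversely, the longer of a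
            forcing and an excluding segment would be contradictory.\<close>
          moreover have "\<not> (\<exists>a. forces T m b' (?d j) (seg x a))
              \<longleftrightarrow> (\<exists>a. \<forall>t. ext (seg x a) t \<longrightarrow> \<not> forces T m b' (?d j) t)"
          proof
            assume "\<not> (\<exists>a. forces T m b' (?d j) (seg x a))"
            then show "\<exists>a. \<forall>t. ext (seg x a) t \<longrightarrow> \<not> forces T m b' (?d j) t"
              using Suc.prems(1)[of "prod_encode (1, prod_encode (b', ?d j))"] by auto
          next
            assume "\<exists>a. \<forall>t. ext (seg x a) t \<longrightarrow> \<not> forces T m b' (?d j) t"
            then obtain a where a: "\<And>t. ext (seg x a) t \<Longrightarrow> \<not> forces T m b' (?d j) t" by blast
            show "\<not> (\<exists>a. forces T m b' (?d j) (seg x a))"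
            proof
              assume "\<exists>a. forces T m b' (?d j) (seg x a)"
              then obtain a' where "forces T m b' (?d j) (seg x a')" by blast
              then have "forces T m b' (?d j) (seg x (max a a'))"
                by (rule forces_mono) (simp add: ext_seg lt2)
              moreover have "ext (seg x a) (seg x (max a a'))" by (simp add: ext_seg lt2)
              ultimately show False using a by blast
            qed
          qed
          ultimately show ?thesis using IH by simp
        qed
      qed
    qed
    then have "signed_mem b x A \<longleftrightarrow> (\<exists>a. \<exists>j\<in>level1 (subtree T (list_decode c)). ?F (?d j) (seg x a))"
      using node(4)[OF x] by auto
    also have "\<dots> \<longleftrightarrow> (\<exists>a. \<exists>d. child c d \<and> lab T d \<noteq> 0 \<and> ?F d (seg x a))"
      unfolding child_level1 ..
    also have "\<dots> \<longleftrightarrow> (\<exists>a. forces T (Suc m) b c (seg x a))"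
      using forces_at_node(2)[OF node(2)] by simp
    finally show ?thesis .
  qed
qed

text \<open>The address 0 codes the empty sequence, hence the root; the sign is 0 because the root
  is a union.\<close>

lemma Sigma_code_forces:
  assumes "x \<in> omega_two" "\<And>e. \<exists>a. decides T m e (seg x a)" "Sigma_code (Suc m) T A"
  shows "x \<in> A \<longleftrightarrow> (\<exists>a. forces T m 0 0 (seg x a))"
  using forces_truth[of x T m 0 "Suc m" 0 A] assms by (simp add: code_def signed_mem_def subtree_def)

section \<open>Generic partitions\<close>

lemma generic_exists:
  fixes P :: "nat \<Rightarrow> nat \<Rightarrow> bool"
  assumes dense: "\<And>k s. binary s \<Longrightarrow> \<exists>t. ext s t \<and> P k t" and s0: "binary s0"
  obtains x where "\<And>i. x i < 2" "lprefix s0 (seg x (llen s0))" "\<And>k. \<exists>a. P k (seg x a)"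
proof -
  have "\<exists>f. \<forall>k. (binary (f k) \<and> ext s0 (f k)) \<and> (ext (f k) (f (Suc k)) \<and> llen (f k) < llen (f (Suc k)) \<and> P k (f (Suc k)))"
  proof (rule dependent_nat_choice)
    show "\<exists>s. binary s \<and> ext s0 s" using s0 ext_refl by blast
  next
    fix s k assume s: "binary s \<and> ext s0 s"
    \<comment> \<open>The extra digit makes the lengths strictly increase, so that the strings
      determine a total function.\<close>
    let ?s = "list_encode (list_decode s @ [0])"
    have "\<And>i. i < llen s \<Longrightarrow> list_decode s ! i < 2" using s by (simp add: binary_def lnth_eq)
    then have "ext s ?s"
      by (auto simp: ext_def binary_def lprefix_def less_Suc_eq nth_append llen_def)
    moreover have "binary ?s" using \<open>ext s ?s\<close> by (simp add: ext_def)
    then obtain t where "ext ?s t" "P k t" using dense by blast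
    moreover have "llen ?s \<le> llen t" using \<open>ext ?s t\<close> by (simp add: ext_def lprefix_iff)
    then have "llen s < llen t" by (simp add: llen_def)
    ultimately show "\<exists>t. (binary t \<and> ext s0 t) \<and> ext s t \<and> llen s < llen t \<and> P k t"
      using s ext_trans by (metis ext_def)
  qed
  then obtain f where f: "\<And>k. binary (f k)" "\<And>k. ext s0 (f k)" "\<And>k. ext (f k) (f (Suc k))"
    "\<And>k. llen (f k) < llen (f (Suc k))" "\<And>k. P k (f (Suc k))" by blast
  have mono: "j \<le> k \<Longrightarrow> lprefix (f j) (f k)" for j k
  proof (induction k rule: dec_induct)
    case (step k)
    then show ?case using f(3)[of k] lprefix_trans by (auto simp: ext_def)
  qed simp
  have len: "k \<le> llen (f k)" for k
    by (induction k) (use f(4) le_less_trans Suc_leI in blast)+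
  define x where "x i = lnth (f (Suc i)) i" for i
  have x: "x i = lnth (f k) i" if "i < llen (f k)" for i k
    using mono[of k "Suc i"] mono[of "Suc i" k] len[of "Suc i"] that
    by (cases "k \<le> Suc i") (simp_all add: x_def lprefix_iff)
  have seg: "seg x (llen (f k)) = f k" for k
  proof -
    have "lprefix (f k) (seg x (llen (f k)))" by (simp add: lprefix_seg x)
    then show ?thesis
      by (metis dual_order.refl list_decode_inverse llen_def llen_seg lprefix_def prefix_length_prefix prefix_order.antisym prefix_order.order_refl)
  qed
  show thesis
  proof
    fix i
    show "x i < 2" using f(1)[of "Suc i"] len[of "Suc i"] by (simp add: x_def binary_def)
  next
    show "lprefix s0 (seg x (llen s0))"
      using f(2)[of 0] x[of _ 0] by (simp add: lprefix_seg ext_def lprefix_iff)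
  next
    fix k
    show "\<exists>a. P k (seg x a)" using f(5)[of k] seg by metis
  qed
qed

section \<open>Images of strings under finite colourings of blocks\<close>

text \<open>The number \<open>w\<close> stands for the map sending a block \<open>v\<close> to its binary digit \<open>v\<close>.\<close>

definition digit :: "nat \<Rightarrow> nat \<Rightarrow> nat" where
  "digit w v = w div 2 ^ v mod 2"

definition image_code :: "nat \<Rightarrow> nat \<Rightarrow> nat" where
  "image_code w q = list_encode (map (digit w) (list_decode q))"

lemma digit_less [simp]: "digit w v < 2"
  by (simp add: digit_def)

lemma digit_power: "digit (2 ^ k) v = (if v = k then 1 else 0)"
proof (cases v k rule: linorder_cases)
  case less
  then obtain d where "k = v + Suc d" using less_imp_add_positive by (metis add_Suc_right gr0_implies_Suc)
  then show ?thesis by (simp add: digit_def power_add)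
qed (simp_all add: digit_def)

text \<open>The bound on \<open>w\<close> is what makes the quantifier over colourings in the
  construction a bounded one.\<close>

lemma digits_exist: "\<forall>v. f v < 2 \<Longrightarrow> \<exists>w<2 ^ N. \<forall>v<N. digit w v = f v"
proof (induction N arbitrary: f)
  case (Suc N)
  then obtain w where w: "w < 2 ^ N" "\<And>v. v < N \<Longrightarrow> digit w v = f (Suc v)"
    using Suc.IH[of "\<lambda>v. f (Suc v)"] Suc.prems by blast
  have f0: "f 0 < 2" using Suc.prems by blast
  have "digit (f 0 + 2 * w) v = f v" if "v < Suc N" for v
    using that w(2) f0 by (cases v) (simp_all add: digit_def div_mult2_eq)
  moreover have "f 0 + 2 * w < 2 ^ Suc N" using w(1) f0 by simp
  ultimately show ?case by blast
qed simp

lemma llen_image_code [simp]: "llen (image_code w q) = llen q"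
  by (simp add: image_code_def llen_def)

lemma lnth_image_code [simp]: "i < llen q \<Longrightarrow> lnth (image_code w q) i = digit w (lnth q i)"
  by (simp add: image_code_def llen_def lnth_eq)

lemma binary_image_code [simp]: "binary (image_code w q)"
  by (simp add: binary_def)

lemma ext_image_code: "lprefix q r \<Longrightarrow> ext (image_code w q) (image_code w r)"
  by (simp add: ext_def) (simp add: lprefix_def image_code_def map_mono_prefix)

lemma lcode_eqI: "llen c = llen d \<Longrightarrow> (\<And>i. i < llen c \<Longrightarrow> lnth c i = lnth d i) \<Longrightarrow> c = d"
  by (metis list_decode_inverse llen_def lnth_eq nth_equalityI)

context function_class
begin

lemma cf_power2 [cfi]: "cf k F \<Longrightarrow> cf k (\<lambda>xs. 2 ^ F xs)"
proof -
  assume F: "cf k F"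
  have "rec_nat 1 (\<lambda>m y. y + y) v = (2 ^ v :: nat)" for v by (induction v) auto
  moreover have "cf k (\<lambda>xs. rec_nat 1 (\<lambda>m y. y + y) (F xs))" by (intro cfi F) simp_all
  ultimately show ?thesis by simp
qed

lemma cf_digit [cfi]: assumes "cf k F" "cf k G" shows "cf k (\<lambda>xs. digit (F xs) (G xs))"
proof -
  have half: "w div 2 = (LEAST q. w < 2 * Suc q)" for w :: nat
    by (rule Least_equality[symmetric]) auto
  have Least: "cf 1 (\<lambda>xs. LEAST q. xs ! 0 < 2 * Suc q)"
  proof (intro cf_Least cfi)
    show "\<exists>q. xs ! 0 < 2 * Suc q" for xs :: "nat list" by (rule exI[of _ "xs ! 0"]) simp
  qed simp_all
  then have half: "cf k (\<lambda>xs. H xs div 2)" if "cf k H" for k H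
    using cf_subst1[of "\<lambda>w. w div 2", OF _ that] Least unfolding half by blast
  have "rec_nat w (\<lambda>m y. y div 2) v = w div 2 ^ v" for w v :: nat
    by (induction v) (simp_all add: div_mult2_eq mult.commute[of 2] flip: div_mult2_eq)
  then have "digit w v = rec_nat w (\<lambda>m y. y div 2) v - 2 * (rec_nat w (\<lambda>m y. y div 2) v div 2)" for w v
    by (simp add: digit_def minus_mult_div_eq_mod)
  moreover have "cf k (\<lambda>xs. rec_nat (F xs) (\<lambda>m y. y div 2) (G xs)
      - 2 * (rec_nat (F xs) (\<lambda>m y. y div 2) (G xs) div 2))"
    by (intro cf_minus cf_times cf_const cf_rec_nat half assms cfi) simp_all
  ultimately show ?thesis by simp
qed

lemma cf_image_code [cfi]:
  assumes "cf k F" "cf k G" shows "cf k (\<lambda>xs. image_code (F xs) (G xs))"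
proof (rule cf_subst2[OF _ assms])
  show "cf 2 (\<lambda>xs. image_code (xs ! 0) (xs ! 1))"
  proof (rule cf_uniqueI)
    show "rel (Suc 2) (\<lambda>ys. llen (ys ! 0) = llen (tl ys ! 1)
        \<and> (\<forall>i<llen (ys ! 0). lnth (ys ! 0) i = digit (tl ys ! 0) (lnth (tl ys ! 1) i)))"
      by (intro cfi) simp_all
  qed (auto intro: lcode_eqI)
qed

end

section \<open>The stages of the construction\<close>

text \<open>\<open>\<exists>y. Q y s\<close> stands for forcing the chosen colour. Exposing the
  witness \<open>y\<close> makes the tested relation \<open>\<Delta>\<close>; the witness may change
  when the string is extended.\<close>

locale stages =
  fixes n :: nat and D Q :: "nat \<Rightarrow> nat \<Rightarrow> bool"
  assumes Delta0_D: "Delta0 (Suc n) 2 (\<lambda>xs. D (xs ! 0) (xs ! 1))"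
    and Delta0_Q: "Delta0 (Suc n) 2 (\<lambda>xs. Q (xs ! 0) (xs ! 1))"
    and D_mono: "D e s \<Longrightarrow> ext s t \<Longrightarrow> D e t"
    and D_dense: "binary s \<Longrightarrow> \<exists>t. ext s t \<and> D e t"
    and Q_mono: "Q y s \<Longrightarrow> ext s t \<Longrightarrow> \<exists>y. Q y t"
    and Q_often: "\<exists>m\<ge>M. \<exists>t y. binary t \<and> lprefix (list_encode (replicate m 0 @ [1])) t \<and> Q y t"
begin

text \<open>These are the restrictions to the blocks below \<open>s\<close> of those elements of \<open>(\<omega>)\<^sup>2\<close> that are not
  constant there.\<close>

definition nontrivial :: "nat \<Rightarrow> nat \<Rightarrow> bool" where
  "nontrivial s w \<longleftrightarrow> digit w 0 = 0 \<and> (\<exists>v<s. digit w v = 1)"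

definition bounded :: "nat \<Rightarrow> nat \<Rightarrow> bool" where
  "bounded s q \<longleftrightarrow> (\<forall>a<llen q. lnth q a \<le> s)"

text \<open>The candidate \<open>z\<close> codes the next string together with a witness for \<open>Q\<close>. The number \<open>2 ^ Suc s\<close>
  is the colouring for which the new block \<open>Suc s\<close> is the only one of colour 1.\<close>

definition good :: "nat \<Rightarrow> nat \<Rightarrow> nat \<Rightarrow> bool" where
  "good s q z \<longleftrightarrow> lprefix q (pfst z) \<and> bounded (Suc s) (pfst z)
    \<and> (\<exists>a<llen (pfst z). lnth (pfst z) a = Suc s) \<and> Q (psnd z) (image_code (2 ^ Suc s) (pfst z))
    \<and> (\<forall>w<2 ^ Suc (Suc s). nontrivial (Suc (Suc s)) w \<longrightarrow> (\<forall>e<Suc s. D e (image_code w (pfst z))))"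

text \<open>A nontrivial \<open>w\<close> colours block 0 with 0 and some existing block
  \<open>v\<close> with 1, so every extension of an image lifts to the string itself. Requirements
  met earlier survive by \<open>D_mono\<close>.\<close>

lemma extend_all:
  assumes "finite F" "bounded s q" "\<And>w e. (w, e) \<in> F \<Longrightarrow> nontrivial (Suc s) w"
  shows "\<exists>r. lprefix q r \<and> bounded s r \<and> (\<forall>(w, e)\<in>F. D e (image_code w r))"
  using assms(1,3)
proof (induction F)
  case empty
  then show ?case using assms(2) lprefix_refl by blast
next
  case (insert we F)
  obtain w e where we: "we = (w, e)" by fastforce
  obtain r where r: "lprefix q r" "bounded s r" "\<forall>(w, e)\<in>F. D e (image_code w r)"
    using insert by auto
  obtain v where v: "v \<le> s" "digit w v = 1" "digit w 0 = 0"
    using insert.prems[of w e] by (auto simp: we nontrivial_def less_Suc_eq_le)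
  obtain t where t: "ext (image_code w r) t" "D e t" using D_dense[of "image_code w r" e] by auto
  then obtain zs where zs: "list_decode t = map (digit w) (list_decode r) @ zs"
    by (auto simp: ext_def lprefix_def image_code_def prefix_def)
  have bin: "b < 2" if "b \<in> set zs" for b
  proof -
    have "b \<in> set (list_decode t)" using that by (simp add: zs)
    with t(1) show ?thesis by (auto simp: ext_def binary_def lnth_eq llen_def in_set_conv_nth)
  qed
  \<comment> \<open>The bit \<open>b\<close> is written as block \<open>b * v\<close>, that is, as
    block 0 or block \<open>v\<close>.\<close>
  let ?r = "list_encode (list_decode r @ map (\<lambda>b. b * v) zs)"
  have "digit w (b * v) = b" if "b < 2" for b
    using that v by (auto simp: less_2_cases_iff)
  then have "map (digit w) (map (\<lambda>b. b * v) zs) = zs" using bin by (auto intro: map_idI)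
  then have t_eq: "image_code w ?r = t"
    by (simp add: image_code_def flip: zs)
  have pre: "lprefix r ?r" by (simp add: lprefix_def)
  have "bounded s ?r"
    unfolding bounded_def
  proof (intro allI impI)
    fix a assume "a < llen ?r"
    then have "lnth ?r a \<in> set (list_decode r) \<union> (\<lambda>b. b * v) ` set zs"
      using nth_mem[of a "list_decode ?r"] by (simp add: lnth_eq llen_def del: nth_mem)
    moreover have "c \<le> s" if "c \<in> set (list_decode r)" for c
      using that r(2) by (auto simp: bounded_def in_set_conv_nth lnth_eq llen_def)
    moreover have "b * v \<le> s" if "b \<in> set zs" for b
      using bin[OF that] v(1) by (auto simp: less_2_cases_iff)
    ultimately show "lnth ?r a \<le> s" by (elim UnE imageE) simp_all
  qed
  moreover have "\<forall>(w, e)\<in>F. D e (image_code w ?r)"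
    using r(3) D_mono ext_image_code[OF pre] by blast
  ultimately show ?case
    using t_eq t(2) lprefix_trans[OF r(1) pre] by (intro exI[of _ ?r]) (simp add: we)
qed

lemma good_exists:
  assumes q: "bounded s q"
  shows "\<exists>z. good s q z"
proof -
  \<comment> \<open>The zeros of \<open>t\<close> have to cover \<open>q\<close>: all blocks of
    \<open>q\<close> are at most \<open>s\<close>, so \<open>2 ^ Suc s\<close> colours every one of
    them 0.\<close>
  obtain m t y where m: "llen q \<le> m" "binary t" "lprefix (list_encode (replicate m 0 @ [1])) t" "Q y t"
    using Q_often by blast
  from m(3) obtain zs where zs: "list_decode t = replicate m 0 @ 1 # zs"
    by (auto simp: lprefix_def prefix_def)
  let ?ts = "drop (llen q) (list_decode t)"
  \<comment> \<open>The rest of \<open>t\<close> is written with blocks 0 and \<open>Suc s\<close>.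
    It contains the digit 1 at position \<open>m\<close>, so the new block really occurs.\<close>
  let ?r = "list_encode (list_decode q @ map (\<lambda>b. b * Suc s) ?ts)"
  have q': "c \<le> s" if "c \<in> set (list_decode q)" for c
    using that q by (auto simp: bounded_def in_set_conv_nth lnth_eq llen_def)
  have bin: "b < 2" if "b \<in> set ?ts" for b
    using m(2) in_set_dropD[OF that] by (auto simp: binary_def lnth_eq llen_def in_set_conv_nth)
  have "digit (2 ^ Suc s) c = 0" if "c \<in> set (list_decode q)" for c
    using q'[OF that] by (simp add: digit_power del: power_Suc)
  then have "map (digit (2 ^ Suc s)) (list_decode q) = replicate (llen q) 0"
    by (intro replicate_eqI) (auto simp: llen_def)
  also have "\<dots> = take (llen q) (list_decode t)" using m(1) by (simp add: zs)
  finally have "map (digit (2 ^ Suc s)) (list_decode q) = take (llen q) (list_decode t)" .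
  moreover have "digit (2 ^ Suc s) (b * Suc s) = b" if "b < 2" for b
    using that by (auto simp: less_2_cases_iff digit_power simp del: power_Suc)
  then have "map (digit (2 ^ Suc s)) (map (\<lambda>b. b * Suc s) ?ts) = ?ts"
    using bin unfolding map_map comp_def by (intro map_idI) blast
  ultimately have t: "image_code (2 ^ Suc s) ?r = t"
    by (simp add: image_code_def)
  have r_bounded: "bounded (Suc s) ?r"
    unfolding bounded_def
  proof (intro allI impI)
    fix a assume "a < llen ?r"
    then have "lnth ?r a \<in> set (list_decode q) \<union> (\<lambda>b. b * Suc s) ` set ?ts"
      using nth_mem[of a "list_decode ?r"] by (simp add: lnth_eq llen_def del: nth_mem)
    moreover have "b * Suc s \<le> Suc s" if "b \<in> set ?ts" for b
      using bin[OF that] by (auto simp: less_2_cases_iff)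
    ultimately show "lnth ?r a \<le> Suc s" using q' by (elim UnE imageE) (simp_all add: le_SucI)
  qed
  define F where "F = {w. w < 2 ^ Suc (Suc s) \<and> nontrivial (Suc (Suc s)) w} \<times> {..<Suc s}"
  have "\<exists>r. lprefix ?r r \<and> bounded (Suc s) r \<and> (\<forall>(w, e)\<in>F. D e (image_code w r))"
    by (rule extend_all[OF _ r_bounded]) (simp_all add: F_def)
  then obtain r where r: "lprefix ?r r" "bounded (Suc s) r" "\<forall>(w, e)\<in>F. D e (image_code w r)"
    by blast
  have "Suc s \<in> set (list_decode ?r)" using m(1) by (auto simp: zs)
  then have "Suc s \<in> set (list_decode r)"
    using r(1) unfolding lprefix_def by (metis set_mono_prefix subsetD)
  then have occ: "\<exists>a<llen r. lnth r a = Suc s"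
    by (auto simp: in_set_conv_nth llen_def lnth_eq)
  obtain y' where "Q y' (image_code (2 ^ Suc s) r)"
    using Q_mono[OF m(4), of "image_code (2 ^ Suc s) r"] ext_image_code[OF r(1), of "2 ^ Suc s"] t by auto
  moreover have "lprefix q r" using r(1) lprefix_trans[of q ?r r] by (simp add: lprefix_def)
  ultimately have "good s q (prod_encode (r, y'))"
    using r(2,3) occ unfolding good_def F_def by auto
  then show ?thesis ..
qed

text \<open>The premise \<open>bounded s q\<close> makes the search succeed on every input, as
  closure under minimisation requires; the actual stages satisfy it.\<close>

definition next_stage :: "nat \<Rightarrow> nat \<Rightarrow> nat" where
  "next_stage s q = pfst (LEAST z. bounded s q \<longrightarrow> good s q z)"

definition stage :: "nat \<Rightarrow> nat" where
  "stage s = rec_nat (list_encode [0]) (\<lambda>s q. next_stage s q) s"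

definition part :: "nat \<Rightarrow> nat" where
  "part a = lnth (stage a) a"

lemma Delta0_fun_part: "Delta0_fun (Suc n) part"
proof (rule Delta0_fun_Sigma_fun)
  have bounded: "Delta0 (Suc n) k (\<lambda>xs. bounded (F xs) (G xs))"
    if "Sigma_fun n k F" "Sigma_fun n k G" for k F G
  proof -
    have "Delta0 (Suc n) 2 (\<lambda>xs. bounded (xs ! 0) (xs ! 1))"
      unfolding bounded_def by (intro cfi) simp_all
    then show ?thesis by (rule Delta.rel_subst2) (fact that)+
  qed
  have nontrivial: "Delta0 (Suc n) k (\<lambda>xs. nontrivial (F xs) (G xs))"
    if "Sigma_fun n k F" "Sigma_fun n k G" for k F G
  proof -
    have "Delta0 (Suc n) 2 (\<lambda>xs. nontrivial (xs ! 0) (xs ! 1))"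
      unfolding nontrivial_def by (intro cfi) simp_all
    then show ?thesis by (rule Delta.rel_subst2) (fact that)+
  qed
  note D = Delta.rel_subst2[OF Delta0_D] and Q = Delta.rel_subst2[OF Delta0_Q]
  have "Delta0 (Suc n) 3 (\<lambda>ys. good (ys ! 0) (ys ! 1) (ys ! 2))"
    unfolding good_def by (intro D Q bounded nontrivial cfi) simp_all
  note good = Delta.rel_subst3[OF this]
  have "Delta0 (Suc n) (Suc 2) (\<lambda>ys. bounded (tl ys ! 0) (tl ys ! 1) \<longrightarrow> good (tl ys ! 0) (tl ys ! 1) (ys ! 0))"
    by (intro Delta.rel_imp bounded good cfi) simp_all
  then have "Sigma_fun n 2 (\<lambda>xs. next_stage (xs ! 0) (xs ! 1))"
    unfolding next_stage_def using good_exists by (intro Delta.cf_pfst Delta.cf_Least) auto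
  note next_cf = Delta.cf_subst2[OF this]
  show "Sigma_fun n 1 (\<lambda>xs. part (xs ! 0))"
    unfolding part_def stage_def by (intro next_cf cfi) simp_all
qed

section \<open>The limit of the stages as an ordered partition\<close>

lemma stage_0: "llen (stage 0) = 1" "lnth (stage 0) 0 = 0"
  using llen_encode[of "[0]"] lnth_encode[of 0 "[0]"]
  by (simp_all add: stage_def del: list_encode.simps llen_encode lnth_encode)

lemma stage_Suc: "bounded s (stage s) \<Longrightarrow> \<exists>z. good s (stage s) z \<and> stage (Suc s) = pfst z"
  using LeastI_ex[OF good_exists, of s "stage s"] by (auto simp: stage_def next_stage_def)

lemma bounded_stage: "bounded s (stage s)"
proof (induction s)
  case 0
  show ?case by (simp add: bounded_def stage_0)
next
  case (Suc s)
  then show ?case using stage_Suc[of s] by (auto simp: good_def)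
qed

lemma stage_good: "\<exists>y. good s (stage s) (prod_encode (stage (Suc s), y))"
  using stage_Suc[OF bounded_stage, of s] by (metis prod_encode_pfst_psnd)

lemma stage_mono: "s \<le> t \<Longrightarrow> lprefix (stage s) (stage t)"
proof (induction t rule: dec_induct)
  case (step t)
  then show ?case using stage_good[of t] lprefix_trans by (auto simp: good_def)
qed simp

lemma Suc_occurs: "\<exists>a<llen (stage (Suc s)). lnth (stage (Suc s)) a = Suc s"
  using stage_good[of s] by (auto simp: good_def)

text \<open>Block \<open>Suc s\<close> exceeds the bound of stage \<open>s\<close>, so its
  occurrence in the next stage lies beyond the old string. Hence position \<open>a\<close> is
  already fixed at stage \<open>a\<close>.\<close>

lemma llen_stage: "s < llen (stage s)"
proof (induction s)
  case 0
  show ?case by (simp add: stage_0)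
next
  case (Suc s)
  obtain a where a: "a < llen (stage (Suc s))" "lnth (stage (Suc s)) a = Suc s"
    using Suc_occurs by blast
  have "\<not> a < llen (stage s)"
  proof
    assume "a < llen (stage s)"
    then have "lnth (stage (Suc s)) a \<le> s"
      using bounded_stage[of s] stage_mono[of s "Suc s"] by (simp add: bounded_def lprefix_iff)
    with a(2) show False by simp
  qed
  with a(1) Suc show ?case by simp
qed

lemma part_eq: "a < llen (stage s) \<Longrightarrow> part a = lnth (stage s) a"
  using stage_mono[of a s] stage_mono[of s a] llen_stage[of a]
  by (cases "a \<le> s") (simp_all add: part_def lprefix_iff)

lemma part_le: "a < llen (stage s) \<Longrightarrow> part a \<le> s"
  using bounded_stage[of s] by (simp add: bounded_def part_eq)

lemma occurs: "i \<le> s \<Longrightarrow> \<exists>a<llen (stage s). part a = i"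
proof -
  assume "i \<le> s"
  have "\<exists>a<llen (stage i). part a = i"
  proof (cases i)
    case 0
    then show ?thesis by (intro exI[of _ 0]) (simp add: part_def stage_0)
  next
    case (Suc j)
    then show ?thesis using Suc_occurs[of j] part_eq by auto
  qed
  moreover have "llen (stage i) \<le> llen (stage s)"
    using stage_mono[OF \<open>i \<le> s\<close>] by (simp add: lprefix_iff)
  ultimately show ?thesis using order_less_le_trans by blast
qed

text \<open>Stage \<open>s\<close> contains every block up to \<open>s\<close> and no later one, so
  the first occurrence of \<open>Suc s\<close> comes after those of all smaller blocks.\<close>

lemma part_in_omega_omega: "part \<in> omega_omega"
proof -
  have "(LEAST a. part a = i) < (LEAST a. part a = j)" if ij: "i < j" for i j
  proof -
    obtain s where s: "j = Suc s" "i \<le> s" using ij by (cases j) auto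
    obtain a where a: "a < llen (stage s)" "part a = i" using occurs[OF s(2)] by blast
    have "part (LEAST a. part a = j) = j" using occurs[of j j] by (auto intro: LeastI)
    then have "llen (stage s) \<le> (LEAST a. part a = j)"
      using part_le[of "LEAST a. part a = j" s] s(1)
      by (cases "(LEAST a. part a = j) < llen (stage s)") simp_all
    moreover have "(LEAST a. part a = i) \<le> a" using a(2) by (rule Least_le)
    ultimately show ?thesis using a(1) by simp
  qed
  moreover have "i \<in> range part" for i using occurs[of i i] by auto
  then have "range part = UNIV" by auto
  ultimately show ?thesis by (simp add: omega_parts_def ordered_surj_def)
qed

section \<open>Coarsenings of the limit partition\<close>

lemma image_code_stage:
  assumes "\<And>v. v \<le> s \<Longrightarrow> digit w v = x v"
  shows "image_code w (stage s) = seg (x \<circ> part) (llen (stage s))"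
proof (rule lcode_eqI)
  fix i assume "i < llen (image_code w (stage s))"
  then have i: "i < llen (stage s)" by simp
  then show "lnth (image_code w (stage s)) i = lnth (seg (x \<circ> part) (llen (stage s))) i"
    using assms[OF part_le[OF i]] part_eq[OF i] by simp
qed simp

lemma coarsening_in_omega_two:
  assumes x: "x \<in> omega_two" shows "x \<circ> part \<in> omega_two"
proof -
  obtain j where "x j = 1" using x by (auto simp: omega_two_iff)
  moreover obtain a where "part a = j" using occurs[of j j] by blast
  moreover have "part 0 = 0" using part_le[of 0 0] by (simp add: stage_0)
  ultimately show ?thesis using x by (auto simp: omega_two_iff)
qed

text \<open>Let \<open>j = Suc k\<close> be the first block coloured 1 by \<open>x\<close>. Up to
  \<open>j\<close>, \<open>x\<close> agrees with the digits of \<open>2 ^ Suc k\<close>, so the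
  colour was forced when block \<open>j\<close> opened; from then on the restrictions of
  \<open>x\<close> are nontrivial and were served at every stage.\<close>

lemma coarsening_generic:
  assumes x: "x \<in> omega_two"
  shows "\<exists>a. D e (seg (x \<circ> part) a)" "\<exists>a y. Q y (seg (x \<circ> part) a)"
proof -
  have x2: "x v < 2" for v using x by (simp add: omega_two_iff)
  have x0: "x 0 = 0" and x1: "\<exists>j. x j = 1" using x by (simp_all add: omega_two_iff)
  define j where "j = (LEAST j. x j = 1)"
  have xj: "x j = 1" using LeastI_ex[OF x1] by (simp add: j_def)
  have less: "x v = 0" if "v < j" for v
    using not_less_Least[of v "\<lambda>j. x j = 1"] that x2[of v] by (auto simp: j_def less_2_cases_iff)
  obtain k where k: "j = Suc k" using xj x0 by (cases j) auto
  show "\<exists>a y. Q y (seg (x \<circ> part) a)"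
  proof -
    have "digit (2 ^ Suc k) v = x v" if "v \<le> Suc k" for v
      unfolding digit_power using that less[of v] xj by (auto simp: k simp del: power_Suc)
    from image_code_stage[OF this] stage_good[of k] show ?thesis
      by (auto simp: good_def)
  qed
  show "\<exists>a. D e (seg (x \<circ> part) a)"
  proof -
    \<comment> \<open>Late enough for \<open>j\<close> to be among the blocks below
      \<open>Suc (Suc s)\<close> and for \<open>e\<close> to be among the requirements below
      \<open>Suc s\<close>.\<close>
    define s where "s = max e k"
    obtain w where w: "w < 2 ^ Suc (Suc s)" "\<And>v. v < Suc (Suc s) \<Longrightarrow> digit w v = x v"
      using digits_exist[of x "Suc (Suc s)"] x2 by auto
    have "nontrivial (Suc (Suc s)) w"
      unfolding nontrivial_def using w(2) x0 xj by (auto intro!: exI[of _ j] simp: k s_def)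
    then have "D e (image_code w (stage (Suc s)))"
      using stage_good[of s] w(1) by (auto simp: good_def s_def)
    then show ?thesis using image_code_stage[of "Suc s" w x] w(2) by auto
  qed
qed

end

section \<open>Pigeonhole on the colours\<close>

lemma often_forced:
  fixes l :: nat
  assumes codes: "\<And>i. i < l \<Longrightarrow> Sigma_code (Suc m) (T i) (C i)" and cover: "omega_two \<subseteq> (\<Union>i<l. C i)"
  shows "\<exists>i<l. \<forall>M. \<exists>k\<ge>M. \<exists>t. binary t \<and> lprefix (list_encode (replicate k 0 @ [1])) t \<and> forces (T i) m 0 0 t"
proof -
  let ?P = "\<lambda>i k. \<exists>t. binary t \<and> lprefix (list_encode (replicate k 0 @ [1])) t \<and> forces (T i) m 0 0 t"
  \<comment> \<open>For \<open>k = 0\<close> the string would begin with 1, and no element of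
    \<open>omega_two\<close> extends it.\<close>
  have some: "\<exists>i<l. ?P i k" if k: "k \<ge> 1" for k
  proof -
    let ?s = "list_encode (replicate k 0 @ [1])"
    have s: "binary ?s" "llen ?s = Suc k" "lnth ?s 0 = 0" "lnth ?s k = 1"
      using k by (auto simp: binary_def nth_append)
    \<comment> \<open>The index pairs a colour with a requirement, so that one element is generic
      for all \<open>l\<close> codes before its colour is known.\<close>
    let ?D = "\<lambda>j s. pfst j < l \<longrightarrow> decides (T (pfst j)) m (psnd j) s"
    have dense: "\<exists>t. ext s t \<and> ?D j t" if "binary s" for j s
      using decides_dense[OF that] by blast
    obtain x where x: "\<And>i. x i < 2" "lprefix ?s (seg x (llen ?s))" "\<And>j. \<exists>a. ?D j (seg x a)"
      by (rule generic_exists[of ?D, OF dense s(1)]) (assumption, rule that)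
    have "x 0 = 0" "x k = 1" using x(2) s(2-) by (auto simp: lprefix_iff)
    with x(1) have x_in: "x \<in> omega_two" by (auto simp: omega_two_iff)
    then obtain i where i: "i < l" "x \<in> C i" using cover by blast
    have "\<exists>a. decides (T i) m e (seg x a)" for e
      using x(3)[of "prod_encode (i, e)"] i(1) by simp
    then obtain a where a: "forces (T i) m 0 0 (seg x a)"
      using Sigma_code_forces[OF x_in _ codes[OF i(1)]] i(2) by blast
    let ?t = "seg x (max a (Suc k))"
    have "forces (T i) m 0 0 ?t" using a by (rule forces_mono) (simp add: ext_seg x(1))
    moreover have "ext (seg x (Suc k)) ?t" by (simp add: ext_seg x(1))
    then have "binary ?t" "lprefix ?s ?t" using x(2) s(2) lprefix_trans by (auto simp: ext_def)
    ultimately show ?thesis using i(1) by blast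
  qed
  show ?thesis
  proof (rule ccontr)
    assume "\<not> ?thesis"
    then have "\<forall>i\<in>{..<l}. eventually (\<lambda>k. \<not> ?P i k) at_top"
      unfolding eventually_at_top_linorder by blast
    then have "eventually (\<lambda>k. \<forall>i\<in>{..<l}. \<not> ?P i k) at_top"
      by (intro eventually_ball_finite) simp_all
    then obtain N where N: "\<And>k. k \<ge> N \<Longrightarrow> \<forall>i\<in>{..<l}. \<not> ?P i k"
      unfolding eventually_at_top_linorder by blast
    from N[of "max N 1"] some[of "max N 1"] show False by auto
  qed
qed

theorem theorem1p3:
  fixes n l :: nat and C :: "nat \<Rightarrow> (nat \<Rightarrow> nat) set"
  assumes "n \<ge> 1" and "l \<ge> 2"
    and "omega_two = (\<Union>i<l. C i)"
    and "disjoint_family_on C {..<l}"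
    and "\<forall>i<l. has_computable_Delta_code n (C i)"
  shows "\<exists>p\<in>omega_omega. Delta0_fun n p \<and> (\<exists>i<l. coarsenings_two p \<subseteq> C i)"
proof -
  obtain m where n: "n = Suc m" using assms(1) by (cases n) auto
  have "\<forall>i. \<exists>T. i < l \<longrightarrow> computable_ltree T \<and> Sigma_code n T (C i)"
    using assms(5) unfolding has_computable_Delta_code_def Delta_code_def by blast
  then obtain T where T: "\<And>i. i < l \<Longrightarrow> computable_ltree (T i)" "\<And>i. i < l \<Longrightarrow> Sigma_code (Suc m) (T i) (C i)"
    unfolding n by metis
  have "\<exists>i<l. \<forall>M. \<exists>k\<ge>M. \<exists>t. binary t \<and> lprefix (list_encode (replicate k 0 @ [1])) t
      \<and> forces (T i) m 0 0 t"
    by (rule often_forced[where C = C]) (use T(2) assms(3) in auto)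
  then obtain i where i: "i < l"
    "\<And>M. \<exists>k\<ge>M. \<exists>t. binary t \<and> lprefix (list_encode (replicate k 0 @ [1])) t \<and> forces (T i) m 0 0 t"
    by blast
  note comp = T(1)[OF i(1)] and code = T(2)[OF i(1)]
  have "Sigma0 (Suc m) 1 (\<lambda>xs. forces (T i) m 0 0 (xs ! 0))"
    by (rule Sigma0_subst3[OF Sigma0_forces[OF comp]]) (intro cfi; simp)+
  \<comment> \<open>The matrix behind the leading quantifier is
    \<open>\<Pi>\<^sup>0\<^sub>m\<close>, hence
    \<open>\<Delta>\<^sup>0\<^sub>m\<^sub>+\<^sub>1\<close>, as the stage construction
    requires.\<close>
  then obtain P where P: "Pi0 m (Suc 1) (\<lambda>ys. P (ys ! 0) (tl ys))"
    "\<And>xs. length xs = 1 \<Longrightarrow> forces (T i) m 0 0 (xs ! 0) \<longleftrightarrow> (\<exists>y. P y xs)"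
    by (elim Sigma0_SucE) (rule that)
  define Q where "Q y s = P y [s]" for y s
  have Q: "forces (T i) m 0 0 s \<longleftrightarrow> (\<exists>y. Q y s)" for s
    using P(2)[of "[s]"] by (simp add: Q_def)
  interpret stages m "decides (T i) m" Q
  proof
    show "Delta0 (Suc m) 2 (\<lambda>xs. decides (T i) m (xs ! 0) (xs ! 1))"
      using comp by (rule Delta0_decides)
    have "Pi0 m 2 (\<lambda>xs. Q (xs ! 0) (xs ! 1))"
      using P(1) unfolding numeral_2_eq_2 One_nat_def
      by (rule Pi0_cong) (auto simp: Q_def length_Suc_conv)
    then show "Delta0 (Suc m) 2 (\<lambda>xs. Q (xs ! 0) (xs ! 1))"
      by (intro Delta0_SucI disjI2)
    show "decides (T i) m e s \<Longrightarrow> ext s t \<Longrightarrow> decides (T i) m e t" for e s t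
      by (rule decides_mono)
    show "binary s \<Longrightarrow> \<exists>t. ext s t \<and> decides (T i) m e t" for s e
      by (rule decides_dense)
    show "Q y s \<Longrightarrow> ext s t \<Longrightarrow> \<exists>y. Q y t" for y s t
      using forces_mono Q by blast
    show "\<exists>k\<ge>M. \<exists>t y. binary t \<and> lprefix (list_encode (replicate k 0 @ [1])) t \<and> Q y t" for M
      using i(2)[of M] unfolding Q by blast
  qed
  have "x \<circ> part \<in> C i" if x: "x \<in> omega_two" for x
    using Sigma_code_forces[OF coarsening_in_omega_two[OF x] coarsening_generic(1)[OF x] code]
      coarsening_generic(2)[OF x] Q by blast
  then have "coarsenings_two part \<subseteq> C i" by (auto simp: coarsenings_two_def)
  with part_in_omega_omega Delta0_fun_part i(1) show ?thesis
    unfolding n by blast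
qed

end
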